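(* There exist absolute constants $c_1,c_2,C>0$ such that the following holds. Let $m\ge d\ge1$, $\ell\ge1$ and $n,N\ge2$ be integers with $n$ a power of two, and let $f\colon[N]^m\to\{0,1\}^{\ell\log n+(\ell+1)n}$ be a $d$-local function. Then \[ \|f(\mathbf{U}_{[N]}^m)-\mathbf{D}_{n,\ell}\|_{TV}\ \ge\ 1-\exp\!\Big(-c_1\frac{n}{\ell^2 d\log N}\Big)-d\Big(\frac{C\,d\log N}{n}\Big)^{\ell}-\exp\!\big(d\ell\log(n)\log(N)-c_2 n\big). \]
   Context: $[N]=\{1,\dots,N\}$, $\mathbf{U}_{[N]}^m$ is the uniform distribution on $[N]^m$, and $f(\mathbf{X})$ denotes the distribution of $f(\mathbf{x})$ for $\mathbf{x}\sim\mathbf{X}$. A function $f\colon[N]^m\to\{0,1\}^n$ is $d$-local if each output bit depends on at most $d$ of the $m$ input coordinates. Total variation distance: $\|\mathbf{P}-\mathbf{Q}\|_{TV}=\max_{\mathcal{E}}(\mathbf{P}(\mathcal{E})-\mathbf{Q}(\mathcal{E}))$. Logarithms are base 2. Distribution $\mathbf{D}_{n,\ell}$: for $n\ge2$ a power of two and integer $\ell\ge1$, $\mathbf{D}_{n,\ell}$ is the distribution over $(\mathbf{i}^{(1)},\dots,\mathbf{i}^{(\ell)},\mathbf{x},\mathbf{y}^{(1)},\dots,\mathbf{y}^{(\ell)})\in\{0,1\}^{\ell\log n+(\ell+1)n}$ where each $\mathbf{i}^{(j)}$ is independently uniform on $\{0,1\}^{\log n}$ (identified with an element of $\mathbb{Z}_n$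 via a fixed bijection), $\mathbf{x}$ is uniform on $\{0,1\}^n$ independent of the shifts, and $\mathbf{y}^{(j)}_k=\mathbf{x}_{k+\mathbf{i}^{(j)}\bmod n}$ for all $j\in[\ell]$, $k\in[n]$. *)

theory Defs
  imports "HOL-Probability.Probability"
begin

definition inputs :: "nat \<Rightarrow> nat \<Rightarrow> nat list set" where
  "inputs N m = {xs. length xs = m \<and> set xs \<subseteq> {1..N}}"

definition unif_inputs :: "nat \<Rightarrow> nat \<Rightarrow> nat list pmf" where
  "unif_inputs N m = pmf_of_set (inputs N m)"

definition d_local :: "nat \<Rightarrow> nat \<Rightarrow> nat \<Rightarrow> nat \<Rightarrow> (nat list \<Rightarrow> bool list) \<Rightarrow> bool" where
  "d_local N m L d f \<longleftrightarrow>
     (\<forall>x\<in>inputs N m. length (f x) = L) \<and>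
     (\<forall>j<L. \<exists>S\<subseteq>{0..<m}. card S \<le> d \<and>
        (\<forall>x\<in>inputs N m. \<forall>y\<in>inputs N m. (\<forall>i\<in>S. x ! i = y ! i) \<longrightarrow> f x ! j = f y ! j))"

definition tv_dist :: "'a pmf \<Rightarrow> 'a pmf \<Rightarrow> real" where
  "tv_dist P Q = (SUP E. measure_pmf.prob P E - measure_pmf.prob Q E)"

text \<open>The distribution D_{n,l}; enc is the fixed bijection from Z_n = {0..<n} to {0,1}^{log n}.
  Output: i^(1) ... i^(l) (encoded), x, y^(1) ... y^(l), with y^(j)_k = x_{(k + i^(j)) mod n}.\<close>
definition D_out :: "nat \<Rightarrow> (nat \<Rightarrow> bool list) \<Rightarrow> nat list \<times> bool list \<Rightarrow> bool list" where
  "D_out n enc = (\<lambda>(is, x). concat (map enc is) @ x @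
       concat (map (\<lambda>i. map (\<lambda>k. x ! ((k + i) mod n)) [0..<n]) is))"

definition D_dist :: "nat \<Rightarrow> nat \<Rightarrow> (nat \<Rightarrow> bool list) \<Rightarrow> bool list pmf" where
  "D_dist n l enc = map_pmf (D_out n enc)
     (pmf_of_set ({is. length is = l \<and> set is \<subseteq> {0..<n}} \<times> {x. length x = n}))"

end

theory Submission
  imports Defs
begin

text \<open>
Condition on all inputs read by the shift bits, together with the few inputs read by unusually many
of the remaining output bits. The shifts are then fixed, and every remaining input is read by at most
t = O(d log N) output bits per block on average. For random shifts the l + 1 copies of a typical
position have no free input common to all of them, since a fixed input collides with probability at
most (t / n)^l. If such copies are unbiased, they disagree with probability of order 1 / l, and
Finner's inequality for variables that are read few times turns this into an exponentially small
probability that all positions are consistent. If instead most of the bits of x are biased, then x is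
close to the majority string on the biased positions, which is exponentially unlikely for uniform x;
only this last case pays for a union bound over the conditionings.
\<close>

section \<open>Averages over coordinates and Finner's inequality\<close>

text \<open>The distance is witnessed by a single event, the image of \<open>typical_seeds\<close>
  under \<open>D_out n enc\<close>. The two cases differ because of how the conditioning enters.
  Once the shifts are constant, consistency of the copies is one fixed event, so the unbiased case
  is bounded under each conditioning separately and the bounds simply average. The majority string,
  in contrast, moves with the conditioning, and one event has to exclude all of these strings: the
  Hamming balls around all of them are removed from the event, and the price is paid in its
  probability under D. Hence, apart from the inputs of the shift bits, only about n / log N inputs
  may be fixed, and Markov's inequality for the degrees then dictates a threshold of order d log N.

  The obstacle in both cases is that output bits share inputs and are not independent. Finner's
  inequality replaces independence at the cost of dividing exponents by the number of readers of an
  input, at most \<open>(l + 1) * thr\<close>. This gives one factor l in the exponent n / (l^2 d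
  log N); the other is the disagreement probability of order 1 / l.\<close>

definition depends_on :: "(('i \<Rightarrow> 'a) \<Rightarrow> 'b) \<Rightarrow> 'i set \<Rightarrow> bool" where
  "depends_on F S \<longleftrightarrow> (\<forall>z z'. (\<forall>i\<in>S. z i = z' i) \<longrightarrow> F z = F z')"

lemma depends_onI: "(\<And>z z'. (\<And>i. i \<in> S \<Longrightarrow> z i = z' i) \<Longrightarrow> F z = F z') \<Longrightarrow> depends_on F S"
  unfolding depends_on_def by blast

lemma depends_onD: "depends_on F S \<Longrightarrow> (\<And>i. i \<in> S \<Longrightarrow> z i = z' i) \<Longrightarrow> F z = F z'"
  unfolding depends_on_def by blast

lemma depends_on_mono: "depends_on F S \<Longrightarrow> S \<subseteq> T \<Longrightarrow> depends_on F T"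
  unfolding depends_on_def by blast

lemma depends_on_comp: "depends_on F S \<Longrightarrow> depends_on (\<lambda>z. h (F z)) S"
  unfolding depends_on_def by (auto intro!: arg_cong[of _ _ h])

text \<open>Arithmetic-geometric mean followed by concavity: the left side is the geometric mean to
  the power \<open>\<theta> * card K\<close>, and a power with exponent at most 1 lies below its
  tangent at 1. The right side is linear, hence averages to 1 as soon as every \<open>r k\<close>
  has mean 1.\<close>

lemma prod_powr_le_linear:
  fixes r :: "'k \<Rightarrow> real" and \<theta> :: real
  assumes K: "finite K" and r: "\<And>k. k \<in> K \<Longrightarrow> r k \<ge> 0" and \<theta>: "\<theta> \<ge> 0" "\<theta> * card K \<le> 1"
  shows "(\<Prod>k\<in>K. r k powr \<theta>) \<le> 1 + \<theta> * (\<Sum>k\<in>K. r k - 1)"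
proof (cases "K = {}")
  case False
  define m where "m = (\<Sum>k\<in>K. r k / card K)"
  define a where "a = \<theta> * card K"
  have cK: "card K > 0" using K False by (simp add: card_gt_0_iff)
  have m0: "m \<ge> 0" unfolding m_def using r by (intro sum_nonneg) auto
  have P0: "(\<Prod>k\<in>K. r k) \<ge> 0" using r by (intro prod_nonneg) auto
  have "(\<Prod>k\<in>K. r k powr \<theta>) = (\<Prod>k\<in>K. r k) powr \<theta>"
    using r by (simp add: prod_powr_distrib)
  also have "\<dots> = ((\<Prod>k\<in>K. r k) powr (1 / card K)) powr a"
    using cK by (simp add: powr_powr a_def)
  also have "\<dots> \<le> m powr a"
    unfolding m_def using arith_geom_mean[OF K False] r \<theta> by (intro powr_mono2) (auto simp: a_def)
  also have "\<dots> \<le> a * m + (1 - a)"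
  proof (cases "m = 0")
    case True
    then show ?thesis using \<theta> by (simp add: a_def)
  next
    case False
    then show ?thesis
      using Youngs_inequality_0[of a "1 - a" m 1] m0 \<theta> by (simp add: a_def)
  qed
  also have "a * m = \<theta> * (\<Sum>k\<in>K. r k)"
    unfolding a_def m_def using cK by (simp flip: sum_divide_distrib)
  finally show ?thesis by (simp add: a_def sum_subtractf algebra_simps)
qed auto

text \<open>A conditional expectation given the other coordinates. It remains a function of the
  whole assignment, so averages nest, and conditioning becomes evaluation at a point
  \<open>z\<close>.\<close>

definition avg :: "'a set \<Rightarrow> 'i \<Rightarrow> (('i \<Rightarrow> 'a) \<Rightarrow> real) \<Rightarrow> ('i \<Rightarrow> 'a) \<Rightarrow> real" where
  "avg A i F z = (\<Sum>a\<in>A. F (z(i := a))) / card A"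

text \<open>The order of the fold is immaterial because single averages commute. On an infinite
  \<open>I\<close> the fold returns \<open>F\<close> itself, which settles the infinite case in the
  lemmas below.\<close>

definition avgs :: "'a set \<Rightarrow> 'i set \<Rightarrow> (('i \<Rightarrow> 'a) \<Rightarrow> real) \<Rightarrow> ('i \<Rightarrow> 'a) \<Rightarrow> real" where
  "avgs A I F = Finite_Set.fold (avg A) F I"

lemma avg_commute: "avg A i (avg A j F) = avg A j (avg A i F)"
proof (cases "i = j")
  case False
  show ?thesis
  proof
    fix z
    show "avg A i (avg A j F) z = avg A j (avg A i F) z"
      unfolding avg_def sum_divide_distrib[symmetric] fun_upd_twist[OF False]
      by (subst sum.swap) simp
  qed
qed simp

interpretation avg: comp_fun_commute "avg A"
  by unfold_locales (auto simp: avg_commute)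

lemma avgs_empty [simp]: "avgs A {} F = F"
  by (simp add: avgs_def)

lemma avgs_insert: "finite I \<Longrightarrow> i \<notin> I \<Longrightarrow> avgs A (insert i I) F = avg A i (avgs A I F)"
  by (simp add: avgs_def)

lemma avgs_insert2: "finite I \<Longrightarrow> i \<notin> I \<Longrightarrow> avgs A (insert i I) F = avgs A I (avg A i F)"
  by (simp add: avgs_def avg.fold_insert2 del: avg.fold_insert)

lemma avgs_Un_disjoint:
  "finite I \<Longrightarrow> finite J \<Longrightarrow> I \<inter> J = {} \<Longrightarrow> avgs A (I \<union> J) F = avgs A J (avgs A I F)"
  by (simp add: avgs_def avg.fold_set_union_disj)

lemma avg_mono: "(\<And>z. F z \<le> G z) \<Longrightarrow> avg A i F z \<le> avg A i G z"
  unfolding avg_def by (intro divide_right_mono sum_mono) auto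

lemma avgs_mono: "(\<And>z. F z \<le> G z) \<Longrightarrow> avgs A I F z \<le> avgs A I G z"
proof (cases "finite I")
  case True
  assume le: "\<And>z. F z \<le> G z"
  show ?thesis using True le
    by (induction I arbitrary: z rule: finite_induct) (auto simp: avgs_insert intro!: avg_mono)
qed (simp add: avgs_def)

lemma avgs_add: "avgs A I (\<lambda>z. F z + G z) z = avgs A I F z + avgs A I G z"
proof (cases "finite I")
  case True
  then have "avgs A I (\<lambda>z. F z + G z) = (\<lambda>z. avgs A I F z + avgs A I G z)"
    by (induction I rule: finite_induct)
      (auto simp: avgs_insert avg_def fun_eq_iff sum.distrib add_divide_distrib)
  then show ?thesis by simp
qed (simp add: avgs_def)

lemma avgs_cmult: "avgs A I (\<lambda>z. c * F z) z = c * avgs A I F z"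
proof (cases "finite I")
  case True
  then have "avgs A I (\<lambda>z. c * F z) = (\<lambda>z. c * avgs A I F z)"
    by (induction I rule: finite_induct)
      (auto simp: avgs_insert avg_def fun_eq_iff sum_distrib_left)
  then show ?thesis by simp
qed (simp add: avgs_def)

lemma avgs_diff: "avgs A I (\<lambda>z. F z - G z) z = avgs A I F z - avgs A I G z"
  using avgs_add[of A I F "\<lambda>z. (- 1) * G z" z] avgs_cmult[of A I "-1" G z] by simp

lemma abs_avgs_le: "\<bar>avgs A I F z\<bar> \<le> avgs A I (\<lambda>z. \<bar>F z\<bar>) z"
proof -
  have "avgs A I F z \<le> avgs A I (\<lambda>z. \<bar>F z\<bar>) z" by (intro avgs_mono) auto
  moreover have "avgs A I (\<lambda>z. (-1) * F z) z \<le> avgs A I (\<lambda>z. \<bar>F z\<bar>) z" by (intro avgs_mono) auto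
  ultimately show ?thesis by (simp add: avgs_cmult[of A I "-1", simplified])
qed

lemma depends_on_avg:
  fixes F :: "('i \<Rightarrow> 'a) \<Rightarrow> real"
  shows "depends_on F S \<Longrightarrow> depends_on (avg A i F) (S - {i})"
proof (rule depends_onI)
  fix z z' :: "'i \<Rightarrow> 'a" assume F: "depends_on F S" and eq: "\<And>j. j \<in> S - {i} \<Longrightarrow> z j = z' j"
  have "F (z(i := a)) = F (z'(i := a))" for a
    using eq by (intro depends_onD[OF F]) auto
  then show "avg A i F z = avg A i F z'" by (simp add: avg_def)
qed

lemma depends_on_avgs: "finite I \<Longrightarrow> depends_on F S \<Longrightarrow> depends_on (avgs A I F) (S - I)"
proof (induction I rule: finite_induct)
  case (insert i I)
  then have "depends_on (avg A i (avgs A I F)) (S - I - {i})" by (intro depends_on_avg) auto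
  with insert show ?case by (simp add: avgs_insert Diff_insert[of S i I])
qed simp

locale averaging =
  fixes A :: "'a set"
  assumes finite_A: "finite A" and A_nonempty: "A \<noteq> {}"
begin

lemma card_A_pos: "card A > 0"
  using finite_A A_nonempty by (simp add: card_gt_0_iff)

lemma avg_indep: "depends_on F S \<Longrightarrow> i \<notin> S \<Longrightarrow> avg A i F = F"
proof
  fix z assume F: "depends_on F S" and i: "i \<notin> S"
  have "F (z(i := a)) = F z" for a using i by (intro depends_onD[OF F]) auto
  then show "avg A i F z = F z" using card_A_pos by (simp add: avg_def)
qed

lemma avgs_indep: "depends_on F S \<Longrightarrow> I \<inter> S = {} \<Longrightarrow> avgs A I F = F"
proof (cases "finite I")
  case True
  assume F: "depends_on F S" and "I \<inter> S = {}"
  with True show ?thesis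
    by (induction I rule: finite_induct) (auto simp: avgs_insert avg_indep[OF F])
qed (simp add: avgs_def)

lemma avgs_const [simp]: "avgs A I (\<lambda>z. c) z = c"
  using avgs_indep[of "\<lambda>z. c" "{}" I] by (simp add: depends_on_def)

lemma avgs_nonneg: "(\<And>z. F z \<ge> 0) \<Longrightarrow> avgs A I F z \<ge> 0"
  using avgs_mono[of "\<lambda>_. 0" F A I z] by simp

lemma avgs_le_const: "(\<And>z. F z \<le> c) \<Longrightarrow> avgs A I F z \<le> c"
  using avgs_mono[of F "\<lambda>_. c" A I z] by simp

text \<open>Tower property: a function averaged over \<open>U\<close> ignores \<open>U\<close>, so
  averaging it over \<open>U\<close> once more changes nothing.\<close>

lemma avgs_avgs_subset:
  assumes "finite I" "U \<subseteq> I"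
  shows "avgs A I (avgs A U F) = avgs A I F"
proof -
  have fin: "finite U" "finite (I - U)" using assms finite_subset by auto
  have "depends_on (avgs A U F) (UNIV - U)"
    using fin by (intro depends_on_avgs) (auto simp: depends_on_def intro!: arg_cong[of _ _ F])
  then have idem: "avgs A U (avgs A U F) = avgs A U F"
    by (rule avgs_indep) auto
  have "avgs A I G = avgs A (I - U) (avgs A U G)" for G
    using avgs_Un_disjoint[of U "I - U" A G] fin assms by (simp add: Un_absorb1)
  then show ?thesis by (metis idem)
qed

text \<open>Hoelder's inequality in one coordinate. Factors ignoring \<open>i\<close> come out as
  constants, and the exponents of the others sum to at most 1. After division of each factor by its
  mean, the linear term of \<open>prod_powr_le_linear\<close> averages to zero.\<close>

lemma avg_Holder:
  fixes \<theta> :: real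
  assumes K: "finite K" and g: "\<And>k z. k \<in> K \<Longrightarrow> g k z \<ge> 0"
    and dep: "\<And>k. k \<in> K \<Longrightarrow> depends_on (g k) (S k)"
    and \<theta>: "\<theta> \<ge> 0" "\<theta> * card {k\<in>K. i \<in> S k} \<le> 1"
  shows "avg A i (\<lambda>z. \<Prod>k\<in>K. g k z powr \<theta>) z \<le> (\<Prod>k\<in>K. avg A i (g k) z powr \<theta>)"
proof -
  define K1 where "K1 = {k\<in>K. i \<in> S k}"
  define K0 where "K0 = {k\<in>K. i \<notin> S k}"
  have KU: "K = K1 \<union> K0" "K1 \<inter> K0 = {}" "finite K1" "finite K0"
    using K by (auto simp: K1_def K0_def)
  define c where "c = (\<Prod>k\<in>K0. g k z powr \<theta>)"
  have c0: "c \<ge> 0" unfolding c_def by (intro prod_nonneg) auto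
  have const: "g k (z(i := a)) = g k z" if "k \<in> K0" for k a
    using that by (intro depends_onD[OF dep]) (auto simp: K0_def)
  define M where "M k = avg A i (g k) z" for k
  have M0: "M k \<ge> 0" if "k \<in> K" for k
    unfolding M_def avg_def using g that by (auto intro!: divide_nonneg_nonneg sum_nonneg)
  have split: "(\<Prod>k\<in>K. g k (z(i := a)) powr \<theta>) = (\<Prod>k\<in>K1. g k (z(i := a)) powr \<theta>) * c" for a
    unfolding KU(1) c_def using KU const by (subst prod.union_disjoint) auto
  have splitM: "(\<Prod>k\<in>K. M k powr \<theta>) = (\<Prod>k\<in>K1. M k powr \<theta>) * c"
    unfolding KU(1) c_def using KU avg_indep[OF dep]
    by (subst prod.union_disjoint) (auto simp: M_def K0_def)
  have "(\<Sum>a\<in>A. \<Prod>k\<in>K1. g k (z(i := a)) powr \<theta>) / card A \<le> (\<Prod>k\<in>K1. M k powr \<theta>)"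
  \<comment> \<open>A zero mean prevents the normalisation, but then the nonnegative factor vanishes
    at every letter, and so does the product, since \<open>0 powr \<theta> = 0\<close> in all
    cases.\<close>
  proof (cases "\<exists>k\<in>K1. M k = 0")
    case True
    then obtain k where k: "k \<in> K1" "M k = 0" by blast
    then have "(\<Sum>a\<in>A. g k (z(i := a))) = 0" using card_A_pos by (simp add: M_def avg_def)
    then have "g k (z(i := a)) = 0" if "a \<in> A" for a
      using that g k finite_A by (subst (asm) sum_nonneg_eq_0_iff) (auto simp: K1_def)
    then have "(\<Prod>k\<in>K1. g k (z(i := a)) powr \<theta>) = 0" if "a \<in> A" for a
      using that k KU by (subst prod_zero_iff) (auto intro!: bexI[of _ k])
    then show ?thesis by (auto intro!: prod_nonneg)
  next
    case False
    then have Mpos: "M k > 0" if "k \<in> K1" for k using M0[of k] that KU by fastforce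
    define P where "P = (\<Prod>k\<in>K1. M k powr \<theta>)"
    have Ppos: "P > 0" unfolding P_def using Mpos by (intro prod_pos) force
    have one: "(\<Prod>k\<in>K1. g k (z(i := a)) powr \<theta>) / P
        \<le> 1 + \<theta> * (\<Sum>k\<in>K1. g k (z(i := a)) / M k - 1)" for a
    proof -
      have "(\<Prod>k\<in>K1. g k (z(i := a)) powr \<theta>) / P = (\<Prod>k\<in>K1. (g k (z(i := a)) / M k) powr \<theta>)"
        unfolding P_def prod_dividef[symmetric] using Mpos g KU
        by (intro prod.cong refl) (subst powr_divide, auto simp: less_imp_le)
      also have "\<dots> \<le> 1 + \<theta> * (\<Sum>k\<in>K1. g k (z(i := a)) / M k - 1)"
        using KU g Mpos \<theta> by (intro prod_powr_le_linear) (auto simp: K1_def less_imp_le)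
      finally show ?thesis .
    qed
    have "(\<Sum>a\<in>A. \<Sum>k\<in>K1. g k (z(i := a)) / M k - 1) = (\<Sum>k\<in>K1. \<Sum>a\<in>A. g k (z(i := a)) / M k - 1)"
      by (rule sum.swap)
    also have "\<dots> = (\<Sum>k\<in>K1. 0)"
    proof (rule sum.cong)
      fix k assume k: "k \<in> K1"
      have "(\<Sum>a\<in>A. g k (z(i := a))) = M k * card A" using card_A_pos by (simp add: M_def avg_def)
      then show "(\<Sum>a\<in>A. g k (z(i := a)) / M k - 1) = 0"
        using Mpos[OF k] by (simp add: sum_subtractf flip: sum_divide_distrib)
    qed simp
    finally have z: "(\<Sum>a\<in>A. \<Sum>k\<in>K1. g k (z(i := a)) / M k - 1) = 0" by simp
    have "(\<Sum>a\<in>A. \<Prod>k\<in>K1. g k (z(i := a)) powr \<theta>) / P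
       \<le> (\<Sum>a\<in>A. 1 + \<theta> * (\<Sum>k\<in>K1. g k (z(i := a)) / M k - 1))"
      unfolding sum_divide_distrib by (intro sum_mono one)
    also have "\<dots> = card A"
      by (simp add: sum.distrib sum_distrib_left[symmetric] z)
    finally show ?thesis using Ppos card_A_pos unfolding P_def[symmetric] by (simp add: field_simps)
  qed
  then show ?thesis
    using c0 unfolding splitM[unfolded M_def] avg_def[of A i "\<lambda>z. \<Prod>k\<in>K. g k z powr \<theta>"] split
    by (simp add: sum_distrib_right[symmetric] mult_right_mono M_def flip: times_divide_eq_left)
qed

text \<open>Finner's inequality: \<^term>\<open>\<theta>\<close> is the reciprocal of a bound on the number of factors that read
  any single coordinate.\<close>

lemma avgs_Finner:
  fixes \<theta> :: real
  assumes I: "finite I" and K: "finite K" and g: "\<And>k z. k \<in> K \<Longrightarrow> g k z \<ge> 0"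
    and dep: "\<And>k. k \<in> K \<Longrightarrow> depends_on (g k) (S k)"
    and \<theta>: "\<theta> \<ge> 0" "\<And>i. i \<in> I \<Longrightarrow> \<theta> * card {k\<in>K. i \<in> S k} \<le> 1"
  shows "avgs A I (\<lambda>z. \<Prod>k\<in>K. g k z powr \<theta>) z \<le> (\<Prod>k\<in>K. avgs A I (g k) z powr \<theta>)"
  using I \<theta>(2)
proof (induction I arbitrary: z rule: finite_induct)
  case (insert i I)
  have "avgs A (insert i I) (\<lambda>z. \<Prod>k\<in>K. g k z powr \<theta>) z
     \<le> avg A i (\<lambda>z. \<Prod>k\<in>K. avgs A I (g k) z powr \<theta>) z"
    using insert by (auto simp: avgs_insert intro!: avg_mono)
  also have "\<dots> \<le> (\<Prod>k\<in>K. avg A i (avgs A I (g k)) z powr \<theta>)"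
  proof (rule avg_Holder[OF K])
    \<comment> \<open>Averaging does not enlarge supports, so the bound on the number of readers
      persists for the next coordinate.\<close>
    show "depends_on (avgs A I (g k)) (S k)" if "k \<in> K" for k
      using depends_on_avgs[OF insert(1) dep[OF that]] by (rule depends_on_mono) auto
  qed (use insert g \<theta> in \<open>auto intro!: avgs_nonneg\<close>)
  finally show ?case using insert by (simp add: avgs_insert)
qed simp

text \<open>The value at \<open>z\<close> only involves assignments that agree with \<open>z\<close>
  off \<open>I\<close> and take letters of \<open>A\<close> on \<open>I\<close>. This lets facts
  that hold only under the conditioning enter an average.\<close>

lemma avgs_mono_off:
  assumes "finite I"
    and "\<And>z'. (\<And>i. i \<notin> I \<Longrightarrow> z' i = z i) \<Longrightarrow> (\<And>i. i \<in> I \<Longrightarrow> z' i \<in> A) \<Longrightarrow> F z' \<le> G z'"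
  shows "avgs A I F z \<le> avgs A I G z"
  using assms
proof (induction I arbitrary: z rule: finite_induct)
  case (insert i I)
  have "avgs A I F (z(i := a)) \<le> avgs A I G (z(i := a))" if "a \<in> A" for a
  proof (rule insert.IH)
    fix z' assume z': "\<And>j. j \<notin> I \<Longrightarrow> z' j = (z(i := a)) j" "\<And>j. j \<in> I \<Longrightarrow> z' j \<in> A"
    show "F z' \<le> G z'"
    proof (rule insert.prems)
      show "z' j = z j" if "j \<notin> insert i I" for j using z'(1)[of j] that by auto
      show "z' j \<in> A" if "j \<in> insert i I" for j
        using z'(1)[of i] z'(2)[of j] that \<open>a \<in> A\<close> \<open>i \<notin> I\<close> by auto
    qed
  qed
  then show ?case
    using insert by (auto simp: avgs_insert avg_def intro!: divide_right_mono sum_mono)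
qed simp

lemma avgs_cong_off:
  assumes "finite I"
    and "\<And>z'. (\<And>i. i \<notin> I \<Longrightarrow> z' i = z i) \<Longrightarrow> (\<And>i. i \<in> I \<Longrightarrow> z' i \<in> A) \<Longrightarrow> F z' = G z'"
  shows "avgs A I F z = avgs A I G z"
  using assms by (intro antisym avgs_mono_off) auto

text \<open>Every coordinate is ignored by some bit, so the coordinates split into groups, the j-th of which
  is ignored by \<^term>\<open>b j\<close>. Resampling group j moves \<^term>\<open>b 0\<close> in L1 by at most twice its
  distance to \<^term>\<open>b j\<close>; after all groups \<^term>\<open>b 0\<close> has become its mean p, at L1 distance
  2 p (1 - p).\<close>

lemma agreement_variance_bound:
  fixes b :: "nat \<Rightarrow> ('i \<Rightarrow> 'a) \<Rightarrow> bool" and z :: "'i \<Rightarrow> 'a"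
  assumes I: "finite I"
    and dep: "\<And>j. j \<le> l \<Longrightarrow> depends_on (b j) (S j)"
    and no_common: "\<And>v. v \<in> I \<Longrightarrow> \<exists>j\<le>l. v \<notin> S j"
  defines "p \<equiv> avgs A I (\<lambda>z. of_bool (b 0 z)) z"
  shows "p * (1 - p) \<le> (real l + 1) * avgs A I (\<lambda>z. of_bool (\<exists>j\<le>l. b j z \<noteq> b 0 z)) z"
proof -
  define F where "F j z = (of_bool (b j z) :: real)" for j z
  define \<delta> where "\<delta> = avgs A I (\<lambda>z. of_bool (\<exists>j\<le>l. b j z \<noteq> b 0 z)) z"
  define G where "G j = {v\<in>I. v \<notin> S j}" for j
  define U where "U s = (\<Union>j<s. G j)" for s
  have UI: "U s \<subseteq> I" for s by (auto simp: U_def G_def)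
  have dist: "avgs A I (\<lambda>z. \<bar>F 0 z - F j z\<bar>) z \<le> \<delta>" if "j \<le> l" for j
    unfolding \<delta>_def
  proof (rule avgs_mono)
    fix z
    show "\<bar>F 0 z - F j z\<bar> \<le> of_bool (\<exists>j\<le>l. b j z \<noteq> b 0 z)"
    proof (cases "b j z = b 0 z")
      case False
      then have "\<exists>j\<le>l. b j z \<noteq> b 0 z" using that by blast
      then show ?thesis by (simp add: F_def of_bool_def)
    qed (simp add: F_def)
  qed
  have depF: "depends_on (F j) (S j)" if "j \<le> l" for j
    unfolding F_def by (rule depends_on_comp[OF dep[OF that]])
  have tel: "avgs A I (\<lambda>z. \<bar>F 0 z - avgs A (U s) (F 0) z\<bar>) z \<le> 2 * real s * \<delta>" if "s \<le> l + 1" for s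
    using that
  proof (induction s)
    case 0
    then show ?case by (simp add: U_def)
  next
    case (Suc s)
    \<comment> \<open>Only the part of group s not yet resampled is new, and disjointness lets the
      averages compose. As \<open>F s\<close> ignores \<open>G'\<close>, resampling moves
      \<open>F 0\<close> only through its difference from \<open>F s\<close>.\<close>
    define G' where "G' = G s - U s"
    have fin: "finite (U s)" "finite G'"
      using I UI[of s] by (auto simp: G'_def G_def intro: finite_subset)
    have GI: "G' \<subseteq> I" by (auto simp: G'_def G_def)
    have "U (Suc s) = G' \<union> U s" by (auto simp: U_def G'_def less_Suc_eq)
    then have US: "avgs A (U (Suc s)) (F 0) = avgs A (U s) (avgs A G' (F 0))"
      using avgs_Un_disjoint[OF fin(2,1), of A "F 0"] by (auto simp: G'_def)
    have Fs: "avgs A G' (F s) = F s"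
      using Suc.prems by (intro avgs_indep[OF depF]) (auto simp: G'_def G_def)
    define H where "H z = F 0 z - avgs A G' (F 0) z" for z
    have "avgs A I (\<lambda>z. \<bar>H z\<bar>) z
       \<le> avgs A I (\<lambda>z. \<bar>F 0 z - F s z\<bar> + avgs A G' (\<lambda>z. \<bar>F 0 z - F s z\<bar>) z) z"
    proof (rule avgs_mono)
      fix z
      have "H z = (F 0 z - F s z) - avgs A G' (\<lambda>z. F 0 z - F s z) z"
        by (simp add: H_def avgs_diff Fs)
      then show "\<bar>H z\<bar> \<le> \<bar>F 0 z - F s z\<bar> + avgs A G' (\<lambda>z. \<bar>F 0 z - F s z\<bar>) z"
        using abs_avgs_le[of A G' "\<lambda>z. F 0 z - F s z" z] by linarith
    qed
    also have "\<dots> = 2 * avgs A I (\<lambda>z. \<bar>F 0 z - F s z\<bar>) z"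
      using avgs_avgs_subset[OF I GI] by (simp add: avgs_add)
    also have "\<dots> \<le> 2 * \<delta>" using dist[of s] Suc.prems by simp
    finally have H: "avgs A I (\<lambda>z. \<bar>H z\<bar>) z \<le> 2 * \<delta>" .
    have "avgs A I (\<lambda>z. \<bar>F 0 z - avgs A (U (Suc s)) (F 0) z\<bar>) z
       \<le> avgs A I (\<lambda>z. \<bar>F 0 z - avgs A (U s) (F 0) z\<bar> + avgs A (U s) (\<lambda>z. \<bar>H z\<bar>) z) z"
    proof (rule avgs_mono)
      fix z
      have "F 0 z - avgs A (U (Suc s)) (F 0) z = (F 0 z - avgs A (U s) (F 0) z) + avgs A (U s) H z"
        unfolding US by (simp add: H_def[abs_def] avgs_diff)
      then show "\<bar>F 0 z - avgs A (U (Suc s)) (F 0) z\<bar>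
          \<le> \<bar>F 0 z - avgs A (U s) (F 0) z\<bar> + avgs A (U s) (\<lambda>z. \<bar>H z\<bar>) z"
        using abs_avgs_le[of A "U s" H z] by linarith
    qed
    also have "\<dots> = avgs A I (\<lambda>z. \<bar>F 0 z - avgs A (U s) (F 0) z\<bar>) z + avgs A I (\<lambda>z. \<bar>H z\<bar>) z"
      using avgs_avgs_subset[OF I UI] by (simp add: avgs_add)
    also have "\<dots> \<le> 2 * real (Suc s) * \<delta>"
      using H Suc by (simp add: algebra_simps)
    finally show ?case .
  qed
  have "U (l + 1) = I" using no_common by (fastforce simp: U_def G_def less_Suc_eq_le)
  with tel[of "l + 1"]
  have le: "avgs A I (\<lambda>z. \<bar>F 0 z - avgs A I (F 0) z\<bar>) z \<le> 2 * (real l + 1) * \<delta>" by (simp add: algebra_simps)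
  \<comment> \<open>For a 0/1 value x and p in [0,1], |x - p| = p + (1 - 2p) x is linear in x. The
    inner average equals p only at assignments that agree with \<open>z\<close> off
    \<open>I\<close>, hence the restricted congruence rule.\<close>
  have "avgs A I (\<lambda>z. \<bar>F 0 z - avgs A I (F 0) z\<bar>) z = avgs A I (\<lambda>z. p + (1 - 2 * p) * F 0 z) z"
  proof (rule avgs_cong_off[OF I])
    fix z' assume z': "\<And>i. i \<notin> I \<Longrightarrow> z' i = z i"
    have "depends_on (avgs A I (F 0)) (UNIV - I)"
      by (intro depends_on_avgs[OF I]) (auto simp: depends_on_def intro!: arg_cong[of _ _ "F 0"])
    then have "avgs A I (F 0) z' = avgs A I (F 0) z" by (rule depends_onD) (use z' in auto)
    then have "avgs A I (F 0) z' = p" by (simp add: p_def F_def[abs_def])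
    moreover have "0 \<le> p" "p \<le> 1" unfolding p_def by (auto intro!: avgs_nonneg avgs_le_const)
    ultimately show "\<bar>F 0 z' - avgs A I (F 0) z'\<bar> = p + (1 - 2 * p) * F 0 z'"
      by (auto simp: F_def)
  qed
  also have "\<dots> = p + (1 - 2 * p) * p"
    by (simp add: avgs_add avgs_cmult p_def F_def)
  finally show ?thesis using le unfolding \<delta>_def by (simp add: algebra_simps)
qed

text \<open>Indicators equal their own powers, so Finner's inequality applies to them directly. The
  result is the bound that about \<open>\<theta> * card K\<close> independent events would
  give.\<close>

lemma read_prob_all_le:
  fixes B :: "'k \<Rightarrow> ('i \<Rightarrow> 'a) \<Rightarrow> bool" and \<theta> :: real
  assumes I: "finite I" and K: "finite K"
    and dep: "\<And>k. k \<in> K \<Longrightarrow> depends_on (B k) (S k)"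
    and \<theta>: "\<theta> > 0" "\<And>i. i \<in> I \<Longrightarrow> \<theta> * card {k\<in>K. i \<in> S k} \<le> 1"
    and fail: "\<And>k. k \<in> K \<Longrightarrow> avgs A I (\<lambda>z. of_bool (\<not> B k z)) z \<ge> \<epsilon>"
  shows "avgs A I (\<lambda>z. of_bool (\<forall>k\<in>K. B k z)) z \<le> exp (- \<epsilon> * \<theta> * card K)"
proof -
  have "avgs A I (\<lambda>z. of_bool (\<forall>k\<in>K. B k z)) z = avgs A I (\<lambda>z. \<Prod>k\<in>K. of_bool (B k z) powr \<theta>) z"
  proof (intro arg_cong[of _ _ "\<lambda>F. avgs A I F z"] ext)
    fix z
    show "of_bool (\<forall>k\<in>K. B k z) = (\<Prod>k\<in>K. of_bool (B k z) powr \<theta>)"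
      using K \<theta> by (cases "\<forall>k\<in>K. B k z") (auto simp: prod_zero_iff)
  qed
  also have "\<dots> \<le> (\<Prod>k\<in>K. avgs A I (\<lambda>z. of_bool (B k z)) z powr \<theta>)"
  proof (rule avgs_Finner[OF I K, where S = S])
    show "depends_on (\<lambda>z. of_bool (B k z) :: real) (S k)" if "k \<in> K" for k
      by (rule depends_on_comp[OF dep[OF that]])
  qed (use \<theta> in auto)
  also have "\<dots> \<le> (\<Prod>k\<in>K. exp (- \<epsilon> * \<theta>))"
  proof (intro prod_mono conjI powr_ge_zero)
    fix k assume k: "k \<in> K"
    have "avgs A I (\<lambda>z. of_bool (B k z)) z = avgs A I (\<lambda>z. 1 - of_bool (\<not> B k z)) z"
      by (intro arg_cong[of _ _ "\<lambda>F. avgs A I F z"] ext) auto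
    also have "\<dots> \<le> 1 - \<epsilon>" using fail[OF k] by (simp add: avgs_diff)
    also have "\<dots> \<le> exp (- \<epsilon>)" using exp_ge_add_one_self[of "- \<epsilon>"] by simp
    finally have "avgs A I (\<lambda>z. of_bool (B k z)) z powr \<theta> \<le> exp (- \<epsilon>) powr \<theta>"
      using \<theta> by (intro powr_mono2 avgs_nonneg) auto
    then show "avgs A I (\<lambda>z. of_bool (B k z)) z powr \<theta> \<le> exp (- \<epsilon> * \<theta>)"
      by (simp add: exp_powr_real)
  qed
  also have "\<dots> = exp (- \<epsilon> * \<theta> * card K)" by (simp add: exp_of_nat_mult[symmetric] mult_ac)
  finally show ?thesis .
qed

text \<open>The moment generating function needed for Chernoff bounds: the power of
  \<open>\<Lambda>\<close> is a product of factors 1 or \<open>\<Lambda>\<close>, each raised to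
  \<open>\<theta>\<close>. Lower tails use \<open>\<Lambda> < 1\<close>, upper tails
  \<open>\<Lambda> > 1\<close>.\<close>

lemma read_moment_le:
  fixes B :: "'k \<Rightarrow> ('i \<Rightarrow> 'a) \<Rightarrow> bool" and \<theta> \<Lambda> :: real
  assumes I: "finite I" and K: "finite K"
    and dep: "\<And>k. k \<in> K \<Longrightarrow> depends_on (B k) (S k)"
    and \<theta>: "\<theta> \<ge> 0" "\<And>i. i \<in> I \<Longrightarrow> \<theta> * card {k\<in>K. i \<in> S k} \<le> 1" and \<Lambda>: "\<Lambda> > 0"
    and q: "\<And>k. k \<in> K \<Longrightarrow> 1 + (\<Lambda> - 1) * avgs A I (\<lambda>z. of_bool (B k z)) z \<le> M"
    and M: "M > 0"
  shows "avgs A I (\<lambda>z. \<Lambda> powr (\<theta> * card {k\<in>K. B k z})) z \<le> M powr (\<theta> * card K)"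
proof -
  define g where "g k z = 1 + (\<Lambda> - 1) * of_bool (B k z)" for k z
  have eg: "avgs A I (g k) z = 1 + (\<Lambda> - 1) * avgs A I (\<lambda>z. of_bool (B k z)) z" for k
    unfolding g_def by (simp add: avgs_add avgs_cmult)
  have g0: "g k z > 0" for k z using \<Lambda> by (simp add: g_def)
  have e0: "avgs A I (g k) z \<ge> 0" for k by (intro avgs_nonneg less_imp_le g0)
  have "avgs A I (\<lambda>z. \<Lambda> powr (\<theta> * card {k\<in>K. B k z})) z = avgs A I (\<lambda>z. \<Prod>k\<in>K. g k z powr \<theta>) z"
  proof (intro arg_cong[of _ _ "\<lambda>F. avgs A I F z"] ext)
    fix z
    have "(\<Prod>k\<in>K. g k z powr \<theta>) = (\<Prod>k\<in>K. if B k z then \<Lambda> powr \<theta> else 1)"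
      by (intro prod.cong) (auto simp: g_def)
    also have "\<dots> = (\<Lambda> powr \<theta>) ^ card {k\<in>K. B k z}"
      using K by (simp add: prod.If_cases Int_def)
    also have "\<dots> = \<Lambda> powr (\<theta> * card {k\<in>K. B k z})"
      using \<Lambda> by (simp add: powr_realpow[symmetric] powr_powr)
    finally show "\<Lambda> powr (\<theta> * card {k\<in>K. B k z}) = (\<Prod>k\<in>K. g k z powr \<theta>)" by simp
  qed
  also have "\<dots> \<le> (\<Prod>k\<in>K. avgs A I (g k) z powr \<theta>)"
  proof (rule avgs_Finner[OF I K, where S = S])
    show "depends_on (g k) (S k)" if "k \<in> K" for k
      unfolding g_def by (rule depends_on_comp[OF dep[OF that]])
  qed (use \<theta> g0 in \<open>auto intro: less_imp_le\<close>)
  also have "\<dots> \<le> (\<Prod>k\<in>K. M powr \<theta>)"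
    using q \<theta> e0 by (intro prod_mono conjI powr_ge_zero powr_mono2) (auto simp: eg)
  also have "\<dots> = M powr (\<theta> * card K)"
    using M by (simp add: powr_powr flip: powr_realpow)
  finally show ?thesis .
qed

section \<open>Uniform lists and the size of Hamming balls\<close>

lemma sum_lists_Suc:
  "(\<Sum>xs | length xs = Suc m \<and> set xs \<subseteq> A. G xs) = (\<Sum>xs | length xs = m \<and> set xs \<subseteq> A. \<Sum>a\<in>A. G (xs @ [a]))"
proof -
  have "(\<Sum>xs | length xs = Suc m \<and> set xs \<subseteq> A. G xs)
      = (\<Sum>(xs, a) \<in> {xs. length xs = m \<and> set xs \<subseteq> A} \<times> A. G (xs @ [a]))"
  proof (rule sum.reindex_bij_witness[of _ "\<lambda>(xs, a). xs @ [a]" "\<lambda>xs. (butlast xs, last xs)"])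
    fix xs assume xs: "xs \<in> {xs. length xs = Suc m \<and> set xs \<subseteq> A}"
    then have "xs \<noteq> []" by auto
    with xs show "(butlast xs, last xs) \<in> {xs. length xs = m \<and> set xs \<subseteq> A} \<times> A"
      by (auto dest: in_set_butlastD)
  qed (auto simp flip: length_greater_0_conv)
  then show ?thesis by (simp add: sum.cartesian_product)
qed

lemma avgs_lists:
  "avgs A {0..<m} (\<lambda>z. G (map z [0..<m])) z = (\<Sum>xs | length xs = m \<and> set xs \<subseteq> A. G xs) / card A ^ m"
proof (induction m arbitrary: G z)
  case 0
  have "{xs. xs = [] \<and> set xs \<subseteq> A} = {[]}" by auto
  then show ?case by simp
next
  case (Suc m)
  have "avg A m (\<lambda>z. G (map z [0..<Suc m])) = (\<lambda>z. (\<Sum>a\<in>A. G (map z [0..<m] @ [a])) / card A)"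
    by (auto simp: avg_def fun_eq_iff intro!: sum.cong arg_cong[of _ _ G])
  then have "avgs A {0..<Suc m} (\<lambda>z. G (map z [0..<Suc m])) z
     = avgs A {0..<m} (\<lambda>z. (\<Sum>a\<in>A. G (map z [0..<m] @ [a])) / card A) z"
    by (simp add: atLeast0_lessThan_Suc avgs_insert2 del: upt_Suc)
  also have "\<dots> = (\<Sum>xs | length xs = m \<and> set xs \<subseteq> A. (\<Sum>a\<in>A. G (xs @ [a])) / card A) / card A ^ m"
    by (rule Suc.IH)
  finally show ?case by (simp add: sum_lists_Suc sum_divide_distrib[symmetric] mult.commute)
qed

end

text \<open>Chernoff's lower tail with base 1/2. Every coordinate is read by one bit only, so the
  exponent \<open>\<theta>\<close> is 1; a factor has mean 3/4, and Markov's inequality at radius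
  \<open>card K / 10\<close> costs 2^(1/10) per position.\<close>

lemma hamming_ball_bound:
  assumes K: "K \<subseteq> {0..<n}"
  shows "real (card {x :: bool list. length x = n \<and> real (card {k\<in>K. x ! k \<noteq> \<mu> k}) \<le> card K / 10})
    \<le> 2 ^ n * (9/10) ^ card K"
proof -
  interpret averaging "UNIV :: bool set" by unfold_locales auto
  have fin: "finite K" using K finite_subset by auto
  let ?H = "\<lambda>z. card {k\<in>K. z k \<noteq> \<mu> k}"
  let ?z = "\<lambda>_::nat. False"
  have half: "avgs UNIV {0..<n} (\<lambda>z. of_bool (z k \<noteq> \<mu> k)) ?z = 1/2" if "k \<in> K" for k
  proof -
    have "avg UNIV k (\<lambda>z. of_bool (z k \<noteq> \<mu> k) :: real) = (\<lambda>z. 1/2)"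
      by (auto simp: avg_def UNIV_bool fun_eq_iff)
    then have "avgs UNIV (insert k ({0..<n} - {k})) (\<lambda>z. of_bool (z k \<noteq> \<mu> k)) ?z = 1/2"
      by (subst avgs_insert2) auto
    then show ?thesis using that K by (simp add: insert_absorb subset_iff)
  qed
  have "card {x :: bool list. length x = n \<and> real (card {k\<in>K. x ! k \<noteq> \<mu> k}) \<le> card K / 10} / 2 ^ n
    = (\<Sum>x | length x = n \<and> set x \<subseteq> UNIV. of_bool (real (card {k\<in>K. x ! k \<noteq> \<mu> k}) \<le> card K / 10)) / real (card (UNIV :: bool set)) ^ n"
    using finite_lists_length_eq[of "UNIV :: bool set" n]
    by (simp add: of_bool_def sum.If_cases Int_def)
  also have "\<dots> = avgs UNIV {0..<n} (\<lambda>z. of_bool (real (card {k\<in>K. map z [0..<n] ! k \<noteq> \<mu> k}) \<le> card K / 10)) ?z"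
    using avgs_lists[of n "\<lambda>x. of_bool (real (card {k\<in>K. x ! k \<noteq> \<mu> k}) \<le> card K / 10)" ?z] by simp
  also have "\<dots> \<le> avgs UNIV {0..<n} (\<lambda>z. 2 powr (card K / 10) * (1/2) powr (1 * real (?H z))) ?z"
  proof (rule avgs_mono)
    fix z
    have eq: "{k\<in>K. map z [0..<n] ! k \<noteq> \<mu> k} = {k\<in>K. z k \<noteq> \<mu> k}" using K by auto
    have "1 \<le> 2 powr (card K / 10) * (1/2) powr (?H z)" if "?H z \<le> real (card K) / 10"
    proof -
      have "(1::real) \<le> 2 powr (card K / 10 - ?H z)" using that by (intro ge_one_powr_ge_zero) auto
      then show ?thesis by (simp add: powr_diff powr_divide)
    qed
    then show "of_bool (real (card {k\<in>K. map z [0..<n] ! k \<noteq> \<mu> k}) \<le> card K / 10)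
        \<le> 2 powr (card K / 10) * (1/2) powr (1 * real (?H z))"
      unfolding eq by auto
  qed
  also have "\<dots> = 2 powr (card K / 10) * avgs UNIV {0..<n} (\<lambda>z. (1/2) powr (1 * real (?H z))) ?z"
    by (rule avgs_cmult)
  also have "\<dots> \<le> 2 powr (card K / 10) * (3/4) powr (1 * real (card K))"
  proof (intro mult_left_mono read_moment_le[where S = "\<lambda>k. {k}" and B = "\<lambda>k z. z k \<noteq> \<mu> k"] fin)
    show "depends_on (\<lambda>z. z k \<noteq> \<mu> k) {k}" for k by (auto simp: depends_on_def)
    show "1 * real (card {k \<in> K. i \<in> {k}}) \<le> 1" for i
      using card_mono[of "{i}" "{k \<in> K. i \<in> {k}}"] by auto
    show "1 + (1 / 2 - 1) * avgs UNIV {0..<n} (\<lambda>z. of_bool (z k \<noteq> \<mu> k)) ?z \<le> 3/4" if "k \<in> K" for k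
      using half[OF that] by simp
  qed auto
  also have "\<dots> = (2 powr (1/10) * (3/4)) powr card K"
    by (subst powr_mult) (auto simp: powr_powr)
  also have "\<dots> \<le> (9/10) powr card K"
  proof (intro powr_mono2)
    \<comment> \<open>Since 2 is below (6/5)^10, the base 2^(1/10) * 3/4 is at most 6/5 * 3/4 =
      9/10.\<close>
    have "(2::real) powr (1/10) \<le> ((6/5) ^ 10) powr (1/10)"
      by (intro powr_mono2) (auto simp: power_divide field_simps)
    also have "\<dots> = ((6/5) powr 10) powr (1/10)" by (subst powr_numeral) auto
    also have "\<dots> = 6/5" by (subst powr_powr) simp
    finally show "2 powr (1/10) * (3/4) \<le> (9/10 :: real)" by simp
  qed auto
  also have "\<dots> = (9/10) ^ card K" by (simp add: powr_realpow)
  finally show ?thesis by (simp add: field_simps)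
qed

section \<open>Collisions under random shifts\<close>

lemma nth_concat_uniform:
  assumes "\<And>ys. ys \<in> set xss \<Longrightarrow> length ys = n" "j < length xss" "i < n"
  shows "concat xss ! (j * n + i) = xss ! j ! i"
  using assms
proof (induction xss arbitrary: j)
  case (Cons ys xss)
  then show ?case by (cases j) (auto simp: nth_append add.assoc)
qed simp

lemma card_lists_pointwise:
  assumes "\<And>j. j < l \<Longrightarrow> finite (P j)"
  shows "card {xs. length xs = l \<and> (\<forall>j<l. xs ! j \<in> P j)} = (\<Prod>j<l. card (P j))"
  using assms
proof (induction l)
  case 0
  have "{xs. xs = [] \<and> (\<forall>j<0. xs ! j \<in> P j)} = {[]}" by auto
  then show ?case by simp
next
  case (Suc l)
  let ?X = "{xs. length xs = l \<and> (\<forall>j<l. xs ! j \<in> P j)}"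
  have "bij_betw (\<lambda>(xs, a). xs @ [a]) (?X \<times> P l) {xs. length xs = Suc l \<and> (\<forall>j<Suc l. xs ! j \<in> P j)}"
  proof (rule bij_betw_byWitness[where f' = "\<lambda>xs. (butlast xs, last xs)"])
    show "(\<lambda>xs. (butlast xs, last xs)) ` {xs. length xs = Suc l \<and> (\<forall>j<Suc l. xs ! j \<in> P j)} \<subseteq> ?X \<times> P l"
    proof (rule image_subsetI)
      fix xs assume "xs \<in> {xs. length xs = Suc l \<and> (\<forall>j<Suc l. xs ! j \<in> P j)}"
      moreover from this have "last xs = xs ! l"
        by (subst last_conv_nth) auto
      ultimately show "(butlast xs, last xs) \<in> ?X \<times> P l"
        by (auto simp: nth_butlast)
    qed
  qed (auto simp: nth_append less_Suc_eq intro!: append_butlast_last_id)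
  from bij_betw_same_card[OF this] Suc show ?case
    by (simp add: card_cartesian_product)
qed

text \<open>The product is at most the (l+1)-st power of the mean. Only l of these factors are
  bounded by \<open>t\<close>; the last one stays a mean, so that summing over inputs can use the
  total degree.\<close>

lemma prod_le_power_mean:
  fixes a :: "nat \<Rightarrow> nat" and t :: real
  assumes "(\<Sum>j\<le>l. real (a j)) \<le> (real l + 1) * t"
  shows "real (\<Prod>j\<le>l. a j) \<le> t ^ l * ((\<Sum>j\<le>l. real (a j)) / (real l + 1))"
proof -
  define x where "x = (\<Sum>j\<le>l. real (a j)) / (real l + 1)"
  have x: "0 \<le> x" "x \<le> t"
    using assms by (auto simp: x_def sum_nonneg divide_le_eq mult.commute)
  define R where "R = (\<Prod>j\<le>l. real (a j))"
  have R: "R \<ge> 0" unfolding R_def by (intro prod_nonneg) auto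
  have "R powr (1 / card {..l}) \<le> x"
    using arith_geom_mean[of "{..l}" "\<lambda>j. real (a j)"]
    by (simp add: x_def R_def sum_divide_distrib[symmetric] add.commute)
  then have "(R powr (1 / (real l + 1))) ^ (l + 1) \<le> x ^ (l + 1)"
    by (intro power_mono) (auto simp: add.commute)
  moreover have "(R powr (1 / (real l + 1))) ^ (l + 1) = R"
  proof (cases "R = 0")
    case False
    then have "(R powr (1 / (real l + 1))) ^ (l + 1) = R powr (1 / (real l + 1) * real (l + 1))"
      using R by (subst powr_realpow[symmetric]) (auto simp: powr_powr simp del: power_Suc)
    also have "1 / (real l + 1) * real (l + 1) = 1" by simp
    finally show ?thesis using R by simp
  qed simp
  moreover have "x ^ (l + 1) \<le> t ^ l * x"
    using x by (simp add: mult.commute[of x] mult_right_mono power_mono)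
  ultimately show ?thesis unfolding R_def x_def by simp
qed

lemma inj_on_mod_shift:
  fixes s n :: nat
  assumes "s < n"
  shows "inj_on (\<lambda>i. (i + n - s) mod n) {0..<n}"
proof (rule inj_onI)
  fix i j assume ij: "i \<in> {0..<n}" "j \<in> {0..<n}" and eq: "(i + n - s) mod n = (j + n - s) mod n"
  have "((i + n - s) mod n + s) mod n = i" "((j + n - s) mod n + s) mod n = j"
    using ij assms by (simp_all add: mod_add_left_eq)
  then show "i = j" using eq by metis
qed

text \<open>Here the position is fixed and the shift varies. Adding \<open>i + j\<close> to both
  sides clears the truncated subtractions.\<close>

lemma inj_on_mod_reflect:
  fixes c n :: nat
  shows "inj_on (\<lambda>i. (c + n - i) mod n) {0..<n}"
proof (rule inj_onI)
  fix i j assume ij: "i \<in> {0..<n}" "j \<in> {0..<n}" and eq: "(c + n - i) mod n = (c + n - j) mod n"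
  have "c + n - i + (i + j) = c + j + n" "c + n - j + (i + j) = c + i + n" using ij by auto
  then have "(c + j) mod n = (c + i) mod n"
    using eq by (metis mod_add_left_eq mod_add_self2)
  moreover have "k = nat ((int ((c + k) mod n) - int c) mod int n)" if "k < n" for k
    using that by (simp add: zmod_int mod_diff_left_eq)
  ultimately show "i = j" using ij by (metis atLeastLessThan_iff)
qed

text \<open>\<open>T j i\<close> stands for the inputs read by bit i of block j, where block 0 is x
  and block j > 0 is y^(j).\<close>

locale bounded_degree_family =
  fixes T :: "nat \<Rightarrow> nat \<Rightarrow> nat set" and l n d :: nat
  assumes finite_T: "\<And>j i. j \<le> l \<Longrightarrow> i < n \<Longrightarrow> finite (T j i)"
    and card_T: "\<And>j i. j \<le> l \<Longrightarrow> i < n \<Longrightarrow> card (T j i) \<le> d"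
    and n_pos: "n > 0"
begin

definition shift_lists :: "nat list set" where
  "shift_lists = {is. length is = l \<and> set is \<subseteq> {0..<n}}"

text \<open>Solves k + shift = i modulo n: the index in block j that carries the copy of x_i. The
  prefixed 0 makes x itself a block of shift zero, and adding \<open>n\<close> avoids
  truncation.\<close>

definition src :: "nat list \<Rightarrow> nat \<Rightarrow> nat \<Rightarrow> nat" where
  "src is j i = (i + n - (0 # is) ! j) mod n"

definition deg :: "nat \<Rightarrow> nat \<Rightarrow> nat" where
  "deg j v = card {i\<in>{0..<n}. v \<in> T j i}"

definition total_deg :: "nat \<Rightarrow> nat" where
  "total_deg v = (\<Sum>j\<le>l. deg j v)"

definition collisions :: "nat set \<Rightarrow> nat list \<Rightarrow> nat set" where
  "collisions W is = {i\<in>{0..<n}. \<exists>v\<in>W. \<forall>j\<le>l. v \<in> T j (src is j i)}"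

lemma finite_shift_lists: "finite shift_lists" and card_shift_lists: "card shift_lists = n ^ l"
  using finite_lists_length_eq[of "{0..<n}" l] card_lists_length_eq[of "{0..<n}" l]
  by (simp_all add: shift_lists_def conj_commute)

lemma src_less: "src is j i < n"
  using n_pos by (simp add: src_def)

lemma src_0: "i < n \<Longrightarrow> src is 0 i = i"
  by (simp add: src_def)

lemma shift_lists_nth: "is \<in> shift_lists \<Longrightarrow> j \<le> l \<Longrightarrow> (0 # is) ! j < n"
  using n_pos by (cases j) (auto simp: shift_lists_def subset_iff)

lemma card_src_le:
  assumes "is \<in> shift_lists" "j \<le> l"
  shows "card {i\<in>{0..<n}. v \<in> T j (src is j i)} \<le> deg j v"
  unfolding deg_def
proof (rule card_inj_on_le)
  show "inj_on (src is j) {i \<in> {0..<n}. v \<in> T j (src is j i)}"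
    using inj_on_mod_shift[OF shift_lists_nth[OF assms]] unfolding src_def
    by (rule inj_on_subset) auto
qed (auto simp: src_less)

lemma sum_total_deg:
  assumes "finite W"
  shows "(\<Sum>v\<in>W. total_deg v) \<le> (l + 1) * (n * d)"
proof -
  have "(\<Sum>v\<in>W. total_deg v) = (\<Sum>v\<in>W. \<Sum>j\<le>l. \<Sum>i\<in>{0..<n}. of_bool (v \<in> T j i))"
    unfolding total_deg_def deg_def by (simp add: of_bool_def sum.If_cases Int_def)
  also have "\<dots> = (\<Sum>j\<le>l. \<Sum>i\<in>{0..<n}. \<Sum>v\<in>W. of_bool (v \<in> T j i))"
    by (subst sum.swap, rule sum.cong[OF refl], rule sum.swap)
  also have "\<dots> \<le> (\<Sum>j\<le>l. \<Sum>i\<in>{0..<n}. d)"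
  proof (intro sum_mono)
    fix j i assume ji: "j \<in> {..l}" "i \<in> {0..<n}"
    have "(\<Sum>v\<in>W. of_bool (v \<in> T j i)) = card {v\<in>W. v \<in> T j i}"
      using assms by (simp add: of_bool_def sum.If_cases Int_def)
    also have "\<dots> \<le> card (T j i)" using ji finite_T by (intro card_mono) auto
    also have "\<dots> \<le> d" using ji card_T by auto
    finally show "(\<Sum>v\<in>W. of_bool (v \<in> T j i)) \<le> d" .
  qed
  finally show ?thesis by simp
qed

text \<open>Double counting over an input v and a position i. Block 0 involves no shift, and every
  other block constrains its own shift alone, leaving at most \<open>deg (Suc j) v\<close> values;
  summing block 0 over i supplies the factor \<open>deg 0 v\<close>.\<close>

lemma sum_collisions:
  assumes "finite W"
  shows "(\<Sum>is\<in>shift_lists. card (collisions W is)) \<le> (\<Sum>v\<in>W. \<Prod>j\<le>l. deg j v)"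
proof -
  let ?Q = "\<lambda>is i v. \<forall>j\<le>l. v \<in> T j (src is j i)"
  have "(\<Sum>is\<in>shift_lists. card (collisions W is))
      \<le> (\<Sum>is\<in>shift_lists. \<Sum>v\<in>W. \<Sum>i\<in>{0..<n}. of_bool (?Q is i v))"
  proof (rule sum_mono)
    fix "is"
    have "collisions W is = (\<Union>v\<in>W. {i\<in>{0..<n}. ?Q is i v})" by (auto simp: collisions_def)
    then have "card (collisions W is) \<le> (\<Sum>v\<in>W. card {i\<in>{0..<n}. ?Q is i v})"
      by (simp only:) (rule card_UN_le[OF assms])
    then show "card (collisions W is) \<le> (\<Sum>v\<in>W. \<Sum>i\<in>{0..<n}. of_bool (?Q is i v))"
      by (simp add: of_bool_def sum.If_cases Int_def)
  qed
  also have "\<dots> = (\<Sum>v\<in>W. \<Sum>i\<in>{0..<n}. \<Sum>is\<in>shift_lists. of_bool (?Q is i v))"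
    by (subst sum.swap, rule sum.cong[OF refl], rule sum.swap)
  also have "\<dots> \<le> (\<Sum>v\<in>W. \<Sum>i\<in>{0..<n}. of_bool (v \<in> T 0 i) * (\<Prod>j<l. deg (Suc j) v))"
  proof (intro sum_mono)
    fix v i assume i: "i \<in> {0..<n}"
    define P where "P j = {s\<in>{0..<n}. v \<in> T (Suc j) ((i + n - s) mod n)}" for j
    have P: "card (P j) \<le> deg (Suc j) v" for j
      unfolding deg_def
    proof (rule card_inj_on_le)
      show "inj_on (\<lambda>s. (i + n - s) mod n) (P j)"
        using inj_on_mod_reflect by (rule inj_on_subset) (auto simp: P_def)
    qed (use n_pos in \<open>auto simp: P_def\<close>)
    have finP: "finite (P j)" for j by (simp add: P_def)
    have "(\<Sum>is\<in>shift_lists. of_bool (?Q is i v)) = card {is\<in>shift_lists. ?Q is i v}"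
      using finite_shift_lists by (simp add: of_bool_def sum.If_cases Int_def)
    also have "\<dots> \<le> of_bool (v \<in> T 0 i) * (\<Prod>j<l. deg (Suc j) v)"
    proof (cases "v \<in> T 0 i")
      case False
      then have empty: "{is\<in>shift_lists. ?Q is i v} = {}" using i src_0 by fastforce
      show ?thesis unfolding empty by simp
    next
      case True
      have "{is\<in>shift_lists. ?Q is i v} \<subseteq> {is. length is = l \<and> (\<forall>j<l. is ! j \<in> P j)}"
      proof safe
        fix "is" j assume A: "is \<in> shift_lists" "?Q is i v" "j < l"
        then have "v \<in> T (Suc j) (src is (Suc j) i)" by auto
        then show "is ! j \<in> P j"
          using A shift_lists_nth[of "is" "Suc j"] by (auto simp: P_def src_def)
      qed (auto simp: shift_lists_def)
      moreover have "finite {is. length is = l \<and> (\<forall>j<l. is ! j \<in> P j)}"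
      proof (rule finite_subset)
        show "{is. length is = l \<and> (\<forall>j<l. is ! j \<in> P j)} \<subseteq> {is. set is \<subseteq> {0..<n} \<and> length is = l}"
          by (auto simp: P_def in_set_conv_nth)
      qed (rule finite_lists_length_eq, simp)
      ultimately have "card {is\<in>shift_lists. ?Q is i v} \<le> card {is. length is = l \<and> (\<forall>j<l. is ! j \<in> P j)}"
        by (intro card_mono)
      also have "\<dots> = (\<Prod>j<l. card (P j))" by (rule card_lists_pointwise[OF finP])
      also have "\<dots> \<le> (\<Prod>j<l. deg (Suc j) v)" using P by (intro prod_mono) auto
      finally show ?thesis using True by simp
    qed
    finally show "(\<Sum>is\<in>shift_lists. of_bool (?Q is i v)) \<le> of_bool (v \<in> T 0 i) * (\<Prod>j<l. deg (Suc j) v)" .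
  qed
  also have "\<dots> = (\<Sum>v\<in>W. \<Prod>j\<le>l. deg j v)"
  proof (rule sum.cong[OF refl])
    fix v
    have "(\<Prod>j\<le>l. deg j v) = deg 0 v * (\<Prod>j<l. deg (Suc j) v)"
      by (cases l) (simp_all add: prod.atMost_Suc_shift lessThan_Suc_atMost del: prod.atMost_Suc)
    then show "(\<Sum>i\<in>{0..<n}. of_bool (v \<in> T 0 i) * (\<Prod>j<l. deg (Suc j) v)) = (\<Prod>j\<le>l. deg j v)"
      by (simp add: sum_distrib_right[symmetric] deg_def of_bool_def sum.If_cases Int_def)
  qed
  finally show ?thesis .
qed

text \<open>Markov's inequality at n / 4. The mean degree kept in \<open>prod_le_power_mean\<close>
  sums over \<open>W\<close> to at most n d, and this n cancels the one in the threshold.\<close>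

lemma card_many_collisions:
  assumes W: "finite W" and low: "\<And>v. v \<in> W \<Longrightarrow> real (total_deg v) \<le> (real l + 1) * t" and t: "t \<ge> 0"
  shows "real (card {is\<in>shift_lists. 4 * card (collisions W is) > n}) \<le> 4 * real d * t ^ l"
proof -
  let ?B = "{is\<in>shift_lists. 4 * card (collisions W is) > n}"
  have "n * card ?B = (\<Sum>is\<in>?B. n)" by simp
  also have "\<dots> \<le> (\<Sum>is\<in>?B. 4 * card (collisions W is))" by (intro sum_mono) auto
  also have "\<dots> \<le> (\<Sum>is\<in>shift_lists. 4 * card (collisions W is))" using finite_shift_lists by (intro sum_mono2) auto
  also have "\<dots> \<le> 4 * (\<Sum>v\<in>W. \<Prod>j\<le>l. deg j v)"
    using sum_collisions[OF W] by (simp add: sum_distrib_left[symmetric])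
  finally have "real (n * card ?B) \<le> real (4 * (\<Sum>v\<in>W. \<Prod>j\<le>l. deg j v))"
    by (simp only: of_nat_le_iff)
  then have "real n * real (card ?B) \<le> 4 * (\<Sum>v\<in>W. real (\<Prod>j\<le>l. deg j v))"
    by (simp only: of_nat_mult of_nat_sum of_nat_numeral)
  also have "\<dots> \<le> 4 * (\<Sum>v\<in>W. t ^ l * (real (total_deg v) / (real l + 1)))"
    using low prod_le_power_mean[of "\<lambda>j. deg j _" l t]
    by (intro mult_left_mono sum_mono) (auto simp: total_deg_def)
  also have "\<dots> = 4 * t ^ l * (real (\<Sum>v\<in>W. total_deg v) / (real l + 1))"
    by (simp add: sum_distrib_left[symmetric] sum_divide_distrib[symmetric])
  also have "\<dots> \<le> 4 * t ^ l * (real ((l + 1) * (n * d)) / (real l + 1))"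
    using sum_total_deg[OF W] t by (intro mult_left_mono divide_right_mono of_nat_mono) auto
  also have "\<dots> = real n * (4 * real d * t ^ l)" by (simp add: field_simps)
  finally show ?thesis using n_pos by simp
qed

lemma card_high_degree:
  assumes "finite W" "t > 0"
  shows "real (card {v\<in>W. real (total_deg v) > (real l + 1) * t}) \<le> real n * real d / t"
proof -
  let ?B = "{v\<in>W. real (total_deg v) > (real l + 1) * t}"
  have "real (card ?B) * ((real l + 1) * t) = (\<Sum>v\<in>?B. (real l + 1) * t)" by simp
  also have "\<dots> \<le> (\<Sum>v\<in>?B. real (total_deg v))" by (intro sum_mono) auto
  also have "\<dots> \<le> real ((l + 1) * (n * d))"
    using sum_total_deg[of ?B] assms by (simp only: of_nat_sum[symmetric] of_nat_le_iff) simp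
  finally have "real (card ?B) * t * (real l + 1) \<le> (real n * real d) * (real l + 1)"
    by (simp add: algebra_simps)
  then have "real (card ?B) * t \<le> real n * real d"
    by (rule mult_right_le_imp_le) simp
  then show ?thesis using assms by (simp add: field_simps)
qed

end

section \<open>Conditioning a local sampler\<close>

locale sampler =
  fixes N m d l n k :: nat and enc :: "nat \<Rightarrow> bool list"
    and F :: "(nat \<Rightarrow> nat) \<Rightarrow> bool list" and S :: "nat \<Rightarrow> nat set"
  assumes N: "N \<ge> 2" and d: "d \<ge> 1" and n: "n > 0"
    and inj_enc: "inj_on enc {0..<n}" and length_enc: "\<And>i. i < n \<Longrightarrow> length (enc i) = k"
    and dep: "\<And>p. p < l * k + (l + 1) * n \<Longrightarrow> depends_on (\<lambda>z. F z ! p) (S p)"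
    and S_sub: "\<And>p. p < l * k + (l + 1) * n \<Longrightarrow> S p \<subseteq> {0..<m}"
    and S_card: "\<And>p. p < l * k + (l + 1) * n \<Longrightarrow> card (S p) \<le> d"
begin

abbreviation pos :: "nat \<Rightarrow> nat \<Rightarrow> nat" where
  "pos j i \<equiv> l * k + (j * n + i)"

lemma pos_less: "j \<le> l \<Longrightarrow> i < n \<Longrightarrow> pos j i < l * k + (l + 1) * n"
proof -
  assume "j \<le> l" "i < n"
  then have "j * n + i < l * n + n" by (intro add_le_less_mono mult_le_mono1)
  then show ?thesis by (simp add: algebra_simps)
qed

sublocale averaging "{1..N}"
  using N by unfold_locales auto

sublocale bounded_degree_family "\<lambda>j i. S (pos j i)" l n d
proof
  fix j i assume ji: "j \<le> l" "i < n"
  show "finite (S (pos j i))"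
    using S_sub[OF pos_less[OF ji]] by (rule finite_subset) simp
  show "card (S (pos j i)) \<le> d" by (intro S_card pos_less ji)
qed (rule n)

text \<open>Conditioning on the inputs in \<open>fixed\<close> determines the shifts. The threshold leaves at most
  n / (40 log N) inputs of high degree, so the number of conditionings is outweighed by the
  probability 0.9^(n/2) of a near-majority set.\<close>

definition thr :: real where
  "thr = 40 * real d * log 2 (real N)"

definition fixed :: "nat set" where
  "fixed = (\<Union>p<l * k. S p) \<union> {v\<in>{0..<m}. real (total_deg v) > (real l + 1) * thr}"

definition free :: "nat set" where
  "free = {0..<m} - fixed"

abbreviation outbit :: "nat \<Rightarrow> nat \<Rightarrow> (nat \<Rightarrow> nat) \<Rightarrow> bool" where
  "outbit j i z \<equiv> F z ! pos j i"

definition bias :: "nat \<Rightarrow> (nat \<Rightarrow> nat) \<Rightarrow> real" where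
  "bias i = avgs {1..N} free (\<lambda>z. of_bool (outbit 0 i z))"

text \<open>The cutoff is the inverse of a base 2^20 = 4^10: a rare bit then has moment factor at
  most 2, while a tenth of the positions deviating gains 4 per position.\<close>

definition biased :: "(nat \<Rightarrow> nat) \<Rightarrow> nat set" where
  "biased z = {i\<in>{0..<n}. bias i z < 1 / 2 ^ 20 \<or> bias i z > 1 - 1 / 2 ^ 20}"

definition near_majority :: "(nat \<Rightarrow> nat) \<Rightarrow> bool list set" where
  "near_majority z = {x. length x = n \<and>
     real (card {i\<in>biased z. x ! i \<noteq> (bias i z > 1 / 2)}) \<le> card (biased z) / 10}"

text \<open>Extensional functions give each conditioning one representative, so the union has at
  most \<open>N ^ card fixed\<close> members.\<close>

definition atypical :: "bool list set" where
  "atypical = (\<Union>z\<in>{z \<in> fixed \<rightarrow>\<^sub>E {1..N}. n \<le> 2 * card (biased z)}. near_majority z)"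

definition good_shifts :: "nat list set" where
  "good_shifts = {is\<in>shift_lists. 4 * card (collisions free is) \<le> n}"

definition typical_seeds :: "(nat list \<times> bool list) set" where
  "typical_seeds = good_shifts \<times> ({x. length x = n} - atypical)"

lemma thr_pos: "thr > 0"
  using N d by (simp add: thr_def)

lemma finite_fixed: "finite fixed" and fixed_sub: "fixed \<subseteq> {0..<m}" and finite_free: "finite free"
proof -
  show sub: "fixed \<subseteq> {0..<m}"
    unfolding fixed_def by (intro Un_least UN_least S_sub) auto
  show "finite fixed" using sub by (rule finite_subset) simp
  show "finite free" by (simp add: free_def)
qed

lemma free_low_degree: "v \<in> free \<Longrightarrow> real (total_deg v) \<le> (real l + 1) * thr"
  by (auto simp: free_def fixed_def)

lemma card_fixed: "real (card fixed) \<le> real (d * (l * k)) + real n / (40 * log 2 (real N))"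
proof -
  let ?H = "{v\<in>{0..<m}. real (total_deg v) > (real l + 1) * thr}"
  have "card (\<Union>p<l * k. S p) \<le> (\<Sum>p<l * k. card (S p))" by (rule card_UN_le) simp
  also have "\<dots> \<le> (\<Sum>p<l * k. d)" by (intro sum_mono S_card) auto
  finally have 1: "card (\<Union>p<l * k. S p) \<le> d * (l * k)" by (simp add: mult_ac)
  have "real (card ?H) \<le> real n * real d / thr"
    by (rule card_high_degree) (auto simp: thr_pos)
  also have "\<dots> = real n / (40 * log 2 (real N))" using d by (simp add: thr_def)
  finally have 2: "real (card ?H) \<le> real n / (40 * log 2 (real N))" .
  have "card fixed \<le> card (\<Union>p<l * k. S p) + card ?H"
    unfolding fixed_def by (rule card_Un_le)
  then show ?thesis using 1 2 by linarith
qed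

text \<open>Conditioning happens at arbitrary assignments, whereas \<open>atypical\<close> is
  indexed by extensional ones; the bias sees only the values on \<open>fixed\<close>.\<close>

lemma bias_restrict: "bias i (restrict z fixed) = bias i z" if "i < n"
proof -
  have "depends_on (bias i) (S (pos 0 i) - free)"
    unfolding bias_def
    by (intro depends_on_avgs finite_free depends_on_comp[OF dep[OF pos_less]]) (use that in auto)
  moreover have "S (pos 0 i) - free \<subseteq> fixed"
    using S_sub[OF pos_less[of 0 i]] that by (auto simp: free_def)
  ultimately show ?thesis
    by (intro depends_onD[where F = "bias i"]) (auto simp: restrict_def)
qed

lemma biased_restrict: "biased (restrict z fixed) = biased z"
  by (auto simp: biased_def bias_restrict)

lemma near_majority_restrict: "near_majority (restrict z fixed) = near_majority z"
proof -
  have "{i\<in>biased z. x ! i \<noteq> (bias i (restrict z fixed) > 1 / 2)} = {i\<in>biased z. x ! i \<noteq> (bias i z > 1 / 2)}" for x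
    by (auto simp: biased_def bias_restrict)
  then show ?thesis by (simp add: near_majority_def biased_restrict)
qed

lemma length_concat_enc:
  assumes "is \<in> shift_lists"
  shows "length (concat (map enc is)) = l * k"
proof -
  have "map length (map enc is) = map (\<lambda>_. k) is"
    using assms length_enc by (auto simp: shift_lists_def subset_iff)
  then show ?thesis using assms
    by (simp add: length_concat sum_list_triv shift_lists_def del: map_map)
qed

lemma D_out_nth:
  assumes "is \<in> shift_lists" "length x = n" "j \<le> l" "i < n"
  shows "D_out n enc (is, x) ! pos j i = x ! ((i + (0 # is) ! j) mod n)"
proof -
  \<comment> \<open>As its own rotation by zero, x joins the other blocks in one concatenation over
    \<open>0 # is\<close>.\<close>
  have "map (\<lambda>k. x ! ((k + 0) mod n)) [0..<n] = x"
    using assms(2) by (intro nth_equalityI) auto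
  then have "D_out n enc (is, x) = concat (map enc is) @
      concat (map (\<lambda>i. map (\<lambda>k. x ! ((k + i) mod n)) [0..<n]) (0 # is))"
    by (simp add: D_out_def)
  then have "D_out n enc (is, x) ! pos j i
     = concat (map (\<lambda>i. map (\<lambda>k. x ! ((k + i) mod n)) [0..<n]) (0 # is)) ! (j * n + i)"
    using length_concat_enc[OF assms(1)] by (simp add: nth_append)
  also have "\<dots> = map (\<lambda>i. map (\<lambda>k. x ! ((k + i) mod n)) [0..<n]) (0 # is) ! j ! i"
    using assms by (intro nth_concat_uniform) (auto simp: shift_lists_def)
  also have "\<dots> = x ! ((i + (0 # is) ! j) mod n)"
    using assms by (subst nth_map) (auto simp: shift_lists_def)
  finally show ?thesis .
qed

lemma D_out_nth_src:
  assumes "is \<in> shift_lists" "length x = n" "j \<le> l" "i < n"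
  shows "D_out n enc (is, x) ! pos j (src is j i) = x ! i"
proof -
  have "(src is j i + (0 # is) ! j) mod n = i"
    using shift_lists_nth[OF assms(1,3)] assms(4) by (simp add: src_def mod_add_left_eq)
  then show ?thesis using D_out_nth[OF assms(1,2,3) src_less] by metis
qed

lemma concat_enc_inj:
  assumes "is \<in> shift_lists" "is' \<in> shift_lists" "concat (map enc is) = concat (map enc is')"
  shows "is = is'"
proof -
  have "map enc is = map enc is'"
  proof (rule concat_injective[OF assms(3)])
    show "length (map enc is) = length (map enc is')" using assms by (simp add: shift_lists_def)
    show "\<forall>(x, y)\<in>set (zip (map enc is) (map enc is')). length x = length y"
    proof safe
      fix x y assume "(x, y) \<in> set (zip (map enc is) (map enc is'))"
      then have "x \<in> enc ` set is" "y \<in> enc ` set is'"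
        by (auto dest: set_zip_leftD set_zip_rightD)
      moreover have "length (enc i) = k" if "i \<in> set is \<union> set is'" for i
        using that assms by (intro length_enc) (auto simp: shift_lists_def)
      ultimately show "length x = length y" by auto
    qed
  qed
  then show ?thesis using assms
    by (intro map_inj_on[of enc] inj_on_subset[OF inj_enc]) (auto simp: shift_lists_def)
qed

section \<open>Probability of the test event under the sampler and under the target\<close>

lemma card_atypical:
  "real (card atypical) \<le> real N ^ card fixed * (2 ^ n * (9/10) powr (n / 2))"
proof -
  let ?Z = "{z \<in> fixed \<rightarrow>\<^sub>E {1..N}. n \<le> 2 * card (biased z)}"
  have finP: "finite (fixed \<rightarrow>\<^sub>E {1..N})" using finite_fixed by (intro finite_PiE) auto
  have "card atypical \<le> (\<Sum>z\<in>?Z. card (near_majority z))"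
    unfolding atypical_def using finP by (intro card_UN_le) auto
  then have "real (card atypical) \<le> (\<Sum>z\<in>?Z. real (card (near_majority z)))"
    by (simp only: of_nat_sum[symmetric] of_nat_le_iff)
  also have "\<dots> \<le> (\<Sum>z\<in>?Z. 2 ^ n * (9/10) powr (n / 2))"
  proof (rule sum_mono)
    fix z assume z: "z \<in> ?Z"
    have "real (card (near_majority z)) \<le> 2 ^ n * (9/10) ^ card (biased z)"
      unfolding near_majority_def by (rule hamming_ball_bound) (auto simp: biased_def)
    also have "(9/10 :: real) ^ card (biased z) = (9/10) powr card (biased z)"
      by (simp add: powr_realpow)
    also have "\<dots> \<le> (9/10) powr (n / 2)" using z by (intro powr_mono') auto
    finally show "real (card (near_majority z)) \<le> 2 ^ n * (9/10) powr (n / 2)" by simp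
  qed
  also have "\<dots> = real (card ?Z) * (2 ^ n * (9/10) powr (n / 2))" by simp
  also have "\<dots> \<le> real (card (fixed \<rightarrow>\<^sub>E {1..N})) * (2 ^ n * (9/10) powr (n / 2))"
    using finP by (intro mult_right_mono of_nat_mono card_mono) auto
  also have "real (card (fixed \<rightarrow>\<^sub>E {1..N})) = real N ^ card fixed"
    using finite_fixed by (simp add: card_PiE)
  finally show ?thesis .
qed

text \<open>An output in the event has x outside the ball of this very conditioning, so more than a
  tenth of the biased bits take their rare value. The moment bound with base 2^20 makes this
  unlikely.\<close>

lemma prob_typical_biased:
  assumes z: "\<And>v. v \<in> fixed \<Longrightarrow> z v \<in> {1..N}" and many: "n \<le> 2 * card (biased z)"
  shows "avgs {1..N} free (\<lambda>z. of_bool (F z \<in> D_out n enc ` typical_seeds)) z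
    \<le> 2 powr (- (n / (2 * (real l + 1) * thr)))"
proof -
  define K where "K = biased z"
  define \<theta> where "\<theta> = 1 / ((real l + 1) * thr)"
  define B where "B i z' \<longleftrightarrow> outbit 0 i z' \<noteq> (bias i z > 1 / 2)" for i z'
  have \<theta>: "\<theta> > 0" using thr_pos by (simp add: \<theta>_def)
  have K: "K \<subseteq> {0..<n}" "finite K" by (auto simp: K_def biased_def)
  have far: "real (card {i\<in>K. B i z'}) > card K / 10" if F: "F z' \<in> D_out n enc ` typical_seeds" for z'
  proof -
    obtain "is" x where s: "is \<in> shift_lists" "length x = n" "x \<notin> atypical" "F z' = D_out n enc (is, x)"
      using F by (auto simp: typical_seeds_def good_shifts_def)
    \<comment> \<open>Restriction turns \<open>z\<close> into one of the indices of
      \<open>atypical\<close>; this is where its values on \<open>fixed\<close> must be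
      letters.\<close>
    have "restrict z fixed \<in> {z \<in> fixed \<rightarrow>\<^sub>E {1..N}. n \<le> 2 * card (biased z)}"
      using z many by (simp add: biased_restrict PiE_def Pi_def)
    then have "near_majority z \<subseteq> atypical"
      unfolding atypical_def using near_majority_restrict by blast
    then have "x \<notin> near_majority z" using s(3) by blast
    moreover have "{i\<in>K. B i z'} = {i\<in>K. x ! i \<noteq> (bias i z > 1 / 2)}"
      using D_out_nth[OF s(1,2), of 0] K by (auto simp: B_def s(4))
    ultimately show ?thesis using s(2) by (simp add: near_majority_def K_def)
  qed
  have "avgs {1..N} free (\<lambda>z. of_bool (F z \<in> D_out n enc ` typical_seeds)) z
    \<le> avgs {1..N} free (\<lambda>z'. (2 ^ 20) powr (- \<theta> * card K / 10) * (2 ^ 20) powr (\<theta> * real (card {i\<in>K. B i z'}))) z"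
  proof (rule avgs_mono)
    fix z'
    have "1 \<le> (2 ^ 20) powr (- \<theta> * card K / 10) * (2 ^ 20 :: real) powr (\<theta> * real (card {i\<in>K. B i z'}))"
      if "F z' \<in> D_out n enc ` typical_seeds"
    proof -
      have "\<theta> * (card K / 10) \<le> \<theta> * real (card {i\<in>K. B i z'})"
        using far[OF that] \<theta> by (intro mult_left_mono) auto
      then show ?thesis
        unfolding powr_add[symmetric] by (intro ge_one_powr_ge_zero) auto
    qed
    then show "of_bool (F z' \<in> D_out n enc ` typical_seeds)
      \<le> (2 ^ 20) powr (- \<theta> * card K / 10) * (2 ^ 20 :: real) powr (\<theta> * real (card {i\<in>K. B i z'}))"
      by (auto simp: of_bool_def)
  qed
  also have "\<dots> = (2 ^ 20) powr (- \<theta> * card K / 10)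
      * avgs {1..N} free (\<lambda>z'. (2 ^ 20) powr (\<theta> * real (card {i\<in>K. B i z'}))) z"
    by (rule avgs_cmult)
  also have "\<dots> \<le> (2 ^ 20) powr (- \<theta> * card K / 10) * 2 powr (\<theta> * real (card K))"
  proof (intro mult_left_mono read_moment_le[where S = "\<lambda>i. S (pos 0 i)" and B = B] finite_free K)
    show "depends_on (B i) (S (pos 0 i))" if "i \<in> K" for i
      unfolding B_def using that K by (intro depends_on_comp[OF dep[OF pos_less]]) auto
    show "\<theta> * real (card {i\<in>K. v \<in> S (pos 0 i)}) \<le> 1" if "v \<in> free" for v
    proof -
      have "card {i\<in>K. v \<in> S (pos 0 i)} \<le> deg 0 v"
        unfolding deg_def using K by (intro card_mono) auto
      also have "\<dots> \<le> total_deg v" unfolding total_deg_def by (intro member_le_sum) auto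
      finally have "real (card {i\<in>K. v \<in> S (pos 0 i)}) \<le> (real l + 1) * thr"
        using free_low_degree[OF that] by linarith
      then show ?thesis using thr_pos by (simp add: \<theta>_def divide_le_eq)
    qed
    show "1 + (2 ^ 20 - 1) * avgs {1..N} free (\<lambda>z. of_bool (B i z)) z \<le> 2" if i: "i \<in> K" for i
    proof -
      have "avgs {1..N} free (\<lambda>z. of_bool (B i z)) z \<le> 1 / 2 ^ 20"
      proof (cases "bias i z > 1 / 2")
        case True
        have "avgs {1..N} free (\<lambda>z. of_bool (B i z)) z = avgs {1..N} free (\<lambda>z. 1 - of_bool (outbit 0 i z)) z"
          using True by (intro arg_cong[of _ _ "\<lambda>G. avgs {1..N} free G z"]) (auto simp: B_def)
        also have "\<dots> = 1 - bias i z" by (simp only: avgs_diff avgs_const bias_def)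
        finally show ?thesis using i True by (auto simp: K_def biased_def)
      next
        case False
        have "avgs {1..N} free (\<lambda>z. of_bool (B i z)) z = bias i z"
          using False unfolding bias_def B_def by simp
        then show ?thesis using i False by (auto simp: K_def biased_def)
      qed
      then show ?thesis by simp
    qed
  qed (use \<theta> in auto)
  \<comment> \<open>The gain is 2^(-2 \<theta> |K|) against a moment of at most 2^(\<theta>
    |K|).\<close>
  also have "(2 ^ 20 :: real) powr (- \<theta> * card K / 10) = 2 powr (20 * (- \<theta> * card K / 10))"
    by (subst powr_powr[symmetric]) simp
  also have "2 powr (20 * (- \<theta> * card K / 10)) * 2 powr (\<theta> * real (card K)) = 2 powr (- (\<theta> * card K))"
    unfolding powr_add[symmetric] by simp
  also have "\<dots> \<le> 2 powr (- (\<theta> * (n / 2)))"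
    using many \<theta> by (intro powr_mono) (auto simp: K_def)
  also have "\<theta> * (n / 2) = n / (2 * (real l + 1) * thr)" by (simp add: \<theta>_def)
  finally show ?thesis .
qed

text \<open>If some assignment compatible with the conditioning lands in the event, its shifts are
  those of all compatible ones, because the shift bits read only fixed inputs. Landing in the event
  then forces every tested position to agree with its copies. Without such an assignment the average
  is zero.\<close>

lemma prob_typical_unbiased:
  assumes few: "2 * card (biased z) < n"
  shows "avgs {1..N} free (\<lambda>z. of_bool (F z \<in> D_out n enc ` typical_seeds)) z
    \<le> exp (- (real n / (2 ^ 23 * (real l + 1) ^ 2 * thr)))"
proof (cases "\<exists>z1. (\<forall>v. v \<notin> free \<longrightarrow> z1 v = z v) \<and> F z1 \<in> D_out n enc ` typical_seeds")
  case False
  have "avgs {1..N} free (\<lambda>z. of_bool (F z \<in> D_out n enc ` typical_seeds)) z \<le> avgs {1..N} free (\<lambda>z. 0) z"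
    using False by (intro avgs_mono_off finite_free) auto
  also have "\<dots> \<le> exp (- (real n / (2 ^ 23 * (real l + 1) ^ 2 * thr)))"
    by (simp only: avgs_const exp_ge_zero)
  finally show ?thesis .
next
  case True
  then obtain z1 "is" x where z1: "\<And>v. v \<notin> free \<Longrightarrow> z1 v = z v"
    and s: "is \<in> shift_lists" "4 * card (collisions free is) \<le> n" "length x = n" "F z1 = D_out n enc (is, x)"
    by (auto simp: typical_seeds_def good_shifts_def)
  define K where "K = {0..<n} - biased z - collisions free is"
  define \<theta> where "\<theta> = 1 / ((real l + 1) * thr)"
  define \<epsilon> where "\<epsilon> = 1 / (2 ^ 21 * (real l + 1))"
  define B where "B i z' \<longleftrightarrow> (\<forall>j\<le>l. outbit j (src is j i) z' = outbit 0 i z')" for i z'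
  define R where "R i = (\<Union>j\<le>l. S (pos j (src is j i)))" for i
  have \<theta>: "\<theta> > 0" using thr_pos by (simp add: \<theta>_def)
  have K: "finite K" "\<And>i. i \<in> K \<Longrightarrow> i < n" by (auto simp: K_def)
  have "n \<le> card K + card (biased z \<union> collisions free is)"
  proof -
    have "card {0..<n} \<le> card (K \<union> (biased z \<union> collisions free is))"
      by (intro card_mono) (auto simp: K_def biased_def collisions_def)
    also have "\<dots> \<le> card K + card (biased z \<union> collisions free is)" by (rule card_Un_le)
    finally show ?thesis by simp
  qed
  also have "\<dots> \<le> card K + (card (biased z) + card (collisions free is))"
    by (intro add_left_mono card_Un_le)
  \<comment> \<open>Fewer than n / 2 positions are biased and at most n / 4 collide, so at least n /
    4 can be tested.\<close>
  finally have cK: "n \<le> 4 * card K" using few s(2) by linarith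
  have all: "\<forall>i\<in>K. B i z'" if z': "\<And>v. v \<notin> free \<Longrightarrow> z' v = z v" and F: "F z' \<in> D_out n enc ` typical_seeds" for z'
  proof -
    obtain is' x' where s': "is' \<in> shift_lists" "length x' = n" "F z' = D_out n enc (is', x')"
      using F by (auto simp: typical_seeds_def good_shifts_def)
    have "concat (map enc is) = concat (map enc is')"
    proof (rule nth_equalityI)
      fix p assume "p < length (concat (map enc is))"
      then have p: "p < l * k" using length_concat_enc[OF s(1)] by simp
      have "F z1 ! p = F z' ! p"
      proof (rule depends_onD[OF dep])
        fix v assume "v \<in> S p"
        then have "v \<in> fixed" using p by (auto simp: fixed_def)
        then show "z1 v = z' v" using z1 z' by (simp add: free_def)
      qed (use p in simp)
      then show "concat (map enc is) ! p = concat (map enc is') ! p"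
        using p length_concat_enc[OF s(1)] length_concat_enc[OF s'(1)]
        by (simp add: s(4) s'(3) D_out_def nth_append)
    qed (simp add: length_concat_enc s s')
    then have "is' = is" using concat_enc_inj s(1) s'(1) by metis
    then show ?thesis
      using D_out_nth_src[OF s'(1,2)] D_out_nth[OF s'(1,2), of 0] K(2) by (auto simp: B_def s'(3))
  qed
  have "avgs {1..N} free (\<lambda>z. of_bool (F z \<in> D_out n enc ` typical_seeds)) z
     \<le> avgs {1..N} free (\<lambda>z. of_bool (\<forall>i\<in>K. B i z)) z"
    using all by (intro avgs_mono_off finite_free) auto
  also have "\<dots> \<le> exp (- \<epsilon> * \<theta> * card K)"
  proof (rule read_prob_all_le[OF finite_free K(1), where S = R])
    show "depends_on (B i) (R i)" if "i \<in> K" for i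
    proof (rule depends_onI)
      fix z z' :: "nat \<Rightarrow> nat" assume eq: "\<And>v. v \<in> R i \<Longrightarrow> z v = z' v"
      have "outbit j (src is j i) z = outbit j (src is j i) z'" if "j \<le> l" for j
        using that eq by (intro depends_onD[OF dep[OF pos_less]]) (auto simp: R_def src_less)
      moreover from this[of 0] have "outbit 0 i z = outbit 0 i z'" using K(2)[OF that] by (simp add: src_0)
      ultimately show "B i z = B i z'" by (auto simp: B_def)
    qed
    \<comment> \<open>A consistency test reads one bit of every block. Since \<open>src\<close> is
      injective within each block, an input meets at most \<open>total_deg v\<close> tests.\<close>
    show "\<theta> * real (card {i\<in>K. v \<in> R i}) \<le> 1" if v: "v \<in> free" for v
    proof -
      have "card {i\<in>K. v \<in> R i} \<le> card (\<Union>j\<le>l. {i\<in>{0..<n}. v \<in> S (pos j (src is j i))})"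
        using K by (intro card_mono) (auto simp: R_def)
      also have "\<dots> \<le> (\<Sum>j\<le>l. card {i\<in>{0..<n}. v \<in> S (pos j (src is j i))})" by (rule card_UN_le) simp
      also have "\<dots> \<le> total_deg v"
        unfolding total_deg_def by (intro sum_mono card_src_le s(1)) auto
      finally have "real (card {i\<in>K. v \<in> R i}) \<le> (real l + 1) * thr"
        using free_low_degree[OF v] by linarith
      then show ?thesis using thr_pos by (simp add: \<theta>_def divide_le_eq)
    qed
    show "avgs {1..N} free (\<lambda>z. of_bool (\<not> B i z)) z \<ge> \<epsilon>" if i: "i \<in> K" for i
    proof -
      define b where "b j z = outbit j (src is j i) z" for j z
      have b0: "b 0 = outbit 0 i" using K(2)[OF i] by (simp add: b_def[abs_def] src_0)
      have bias_b0: "bias i = avgs {1..N} free (\<lambda>z. of_bool (b 0 z))"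
        unfolding bias_def b0 ..
      have "bias i z * (1 - bias i z)
         \<le> (real l + 1) * avgs {1..N} free (\<lambda>z. of_bool (\<exists>j\<le>l. b j z \<noteq> b 0 z)) z"
        unfolding bias_b0
      proof (rule agreement_variance_bound[OF finite_free, where S = "\<lambda>j. S (pos j (src is j i))"])
        show "depends_on (b j) (S (pos j (src is j i)))" if "j \<le> l" for j
          unfolding b_def by (intro dep pos_less that src_less)
        show "\<exists>j\<le>l. v \<notin> S (pos j (src is j i))" if "v \<in> free" for v
          using i that by (auto simp: K_def collisions_def)
      qed
      also have "(\<lambda>z. of_bool (\<exists>j\<le>l. b j z \<noteq> b 0 z)) = (\<lambda>z. of_bool (\<not> B i z) :: real)"
        by (auto simp: B_def b0 b_def fun_eq_iff)
      finally have "bias i z * (1 - bias i z) \<le> (real l + 1) * avgs {1..N} free (\<lambda>z. of_bool (\<not> B i z)) z" .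
      moreover have "1 / 2 ^ 21 \<le> bias i z * (1 - bias i z)"
      proof -
        have b: "1 / 2 ^ 20 \<le> bias i z" "bias i z \<le> 1 - 1 / 2 ^ 20"
          using i by (auto simp: K_def biased_def)
        \<comment> \<open>On an interval symmetric about 1/2 the parabola p (1 - p) is smallest at
          the end points; there it exceeds 2^(-21).\<close>
        have "0 \<le> (bias i z - 1 / 2 ^ 20) * (1 - 1 / 2 ^ 20 - bias i z)"
          using b by (intro mult_nonneg_nonneg) auto
        also have "\<dots> = bias i z * (1 - bias i z) - 1 / 2 ^ 20 * (1 - 1 / 2 ^ 20)" by algebra
        finally show ?thesis by simp
      qed
      ultimately show ?thesis by (simp add: \<epsilon>_def field_simps)
    qed
  qed (rule \<theta>)
  also have "\<dots> \<le> exp (- \<epsilon> * \<theta> * (real n / 4))"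
  proof -
    have "\<epsilon> > 0" by (simp add: \<epsilon>_def add_pos_nonneg)
    then have "\<epsilon> * \<theta> * (real n / 4) \<le> \<epsilon> * \<theta> * real (card K)"
      using cK \<theta> by (intro mult_left_mono) auto
    then show ?thesis by simp
  qed
  \<comment> \<open>Here 2^23 = 2^21 * 4, and \<open>\<epsilon>\<close> and \<open>\<theta>\<close>
    contribute one factor l + 1 each.\<close>
  also have "- \<epsilon> * \<theta> * (real n / 4) = - (real n / (2 ^ 23 * (real l + 1) ^ 2 * thr))"
    by (simp add: \<epsilon>_def \<theta>_def power2_eq_square)
  finally show ?thesis .
qed

text \<open>Both cases give a bound uniform over the values on \<open>fixed\<close>, which therefore
  survives averaging over them. The constant collects 2^23, a factor 4 from replacing l + 1 by 2 l,
  and the 40 of \<open>thr\<close>.\<close>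

lemma prob_typical_sampled:
  assumes l: "l \<ge> 1"
  shows "avgs {1..N} {0..<m} (\<lambda>z. of_bool (F z \<in> D_out n enc ` typical_seeds)) z0
    \<le> exp (- (1 / (2 ^ 25 * 40)) * real n / ((real l)\<^sup>2 * real d * log 2 (real N)))"
proof -
  let ?e = "- (1 / (2 ^ 25 * 40)) * real n / ((real l)\<^sup>2 * real d * log 2 (real N))"
  let ?G = "\<lambda>z. of_bool (F z \<in> D_out n enc ` typical_seeds) :: real"
  have "(real l + 1)\<^sup>2 \<le> (2 * real l)\<^sup>2" using l by (intro power_mono) auto
  then have l2: "(real l + 1)\<^sup>2 \<le> 4 * (real l)\<^sup>2" by (simp add: power_mult_distrib)
  have unb: "- (real n / (2 ^ 23 * (real l + 1)\<^sup>2 * thr)) \<le> ?e"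
  proof -
    have "real n / (2 ^ 23 * (4 * (real l)\<^sup>2) * thr) \<le> real n / (2 ^ 23 * (real l + 1)\<^sup>2 * thr)"
      using l l2 thr_pos by (intro divide_left_mono mult_right_mono mult_left_mono mult_pos_pos) (auto simp: add_pos_nonneg)
    then show ?thesis by (simp add: thr_def mult_ac)
  qed
  have bi: "2 powr (- (n / (2 * (real l + 1) * thr))) \<le> exp (- (real n / (2 ^ 23 * (real l + 1)\<^sup>2 * thr)))"
  proof -
    have "1 / 2 \<le> ln (2::real)" using ln_add_one_self_le_self2[of "-1/2"] by (simp add: ln_div)
    then have "n / (2 * (real l + 1) * thr) * (1 / 2) \<le> n / (2 * (real l + 1) * thr) * ln 2"
      using thr_pos by (intro mult_left_mono) auto
    moreover have "real n / (2 ^ 23 * (real l + 1)\<^sup>2 * thr) \<le> n / (2 * (real l + 1) * thr * 2)"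
    proof (intro divide_left_mono)
      have "4 * (real l + 1) \<le> 2 ^ 23 * (real l + 1)\<^sup>2"
        unfolding power2_eq_square mult.assoc[symmetric] by (intro mult_right_mono) auto
      then have "4 * (real l + 1) * thr \<le> 2 ^ 23 * (real l + 1)\<^sup>2 * thr"
        using thr_pos by (intro mult_right_mono) auto
      then show "2 * (real l + 1) * thr * 2 \<le> 2 ^ 23 * (real l + 1)\<^sup>2 * thr" by (simp add: algebra_simps)
    qed (use thr_pos in \<open>auto simp: add_pos_nonneg intro!: mult_pos_pos\<close>)
    ultimately show ?thesis by (simp add: powr_def mult_ac)
  qed
  have cond: "avgs {1..N} free ?G z \<le> exp ?e" if "\<And>v. v \<in> fixed \<Longrightarrow> z v \<in> {1..N}" for z
  proof (cases "n \<le> 2 * card (biased z)")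
    case True
    have "avgs {1..N} free ?G z \<le> 2 powr (- (n / (2 * (real l + 1) * thr)))"
      by (rule prob_typical_biased[OF that True])
    also have "\<dots> \<le> exp (- (real n / (2 ^ 23 * (real l + 1)\<^sup>2 * thr)))" by (rule bi)
    also have "\<dots> \<le> exp ?e" using unb by simp
    finally show ?thesis .
  next
    case False
    then have "avgs {1..N} free ?G z \<le> exp (- (real n / (2 ^ 23 * (real l + 1)\<^sup>2 * thr)))"
      by (intro prob_typical_unbiased) simp
    also have "\<dots> \<le> exp ?e" using unb by simp
    finally show ?thesis .
  qed
  have part: "{0..<m} = free \<union> fixed" "free \<inter> fixed = {}"
    using fixed_sub by (auto simp: free_def)
  have "avgs {1..N} {0..<m} ?G z0 = avgs {1..N} fixed (avgs {1..N} free ?G) z0"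
    unfolding part(1) avgs_Un_disjoint[OF finite_free finite_fixed part(2)] ..
  also have "\<dots> \<le> avgs {1..N} fixed (\<lambda>_. exp ?e) z0"
    by (intro avgs_mono_off finite_fixed cond)
  also have "\<dots> = exp ?e" by (rule avgs_const)
  finally show ?thesis .
qed

text \<open>Shifts and x are independent, so the two failure probabilities add up at most. The
  preimage of the event contains the typical seeds, which reduces everything to counting
  seeds.\<close>

lemma prob_typical_D:
  "measure_pmf.prob (D_dist n l enc) (D_out n enc ` typical_seeds)
    \<ge> 1 - 4 * real d * (thr / real n) ^ l - real N ^ card fixed * (9/10) powr (n / 2)"
proof -
  let ?X = "{x :: bool list. length x = n}"
  have X: "finite ?X" "card ?X = 2 ^ n"
    using finite_lists_length_eq[of "UNIV :: bool set" n] card_lists_length_eq[of "UNIV :: bool set" n] by simp_all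
  define a where "a = real (card good_shifts) / real n ^ l"
  define b where "b = real (card (?X - atypical)) / 2 ^ n"
  have good_sub: "good_shifts \<subseteq> shift_lists" by (auto simp: good_shifts_def)
  have "card shift_lists = card good_shifts + card {is\<in>shift_lists. 4 * card (collisions free is) > n}"
    using finite_shift_lists
    by (subst card_Un_disjoint[symmetric]) (auto simp: good_shifts_def intro!: arg_cong[of _ _ card])
  moreover have "real (card {is\<in>shift_lists. 4 * card (collisions free is) > n}) \<le> 4 * real d * thr ^ l"
    using thr_pos by (intro card_many_collisions finite_free free_low_degree) auto
  ultimately have "real n ^ l - 4 * real d * thr ^ l \<le> real (card good_shifts)"
    using card_shift_lists by (simp flip: of_nat_power)
  then have "(real n ^ l - 4 * real d * thr ^ l) / real n ^ l \<le> a"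
    unfolding a_def by (intro divide_right_mono) auto
  then have a1: "1 - a \<le> 4 * real d * (thr / real n) ^ l"
    using n by (simp add: diff_divide_distrib power_divide)
  have "real (card ?X) \<le> real (card (?X - atypical)) + real (card atypical)"
  proof -
    have fin: "finite atypical"
      by (rule finite_subset[OF _ X(1)]) (auto simp: atypical_def near_majority_def)
    have "card ?X \<le> card ((?X - atypical) \<union> atypical)" using X(1) fin by (intro card_mono) auto
    also have "\<dots> \<le> card (?X - atypical) + card atypical" by (rule card_Un_le)
    finally show ?thesis by linarith
  qed
  also have "\<dots> \<le> real (card (?X - atypical)) + real N ^ card fixed * (2 ^ n * (9/10) powr (n / 2))"
    using card_atypical by simp
  finally have "real (card ?X) / 2 ^ n
      \<le> (real (card (?X - atypical)) + real N ^ card fixed * (2 ^ n * (9/10) powr (n / 2))) / 2 ^ n"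
    by (intro divide_right_mono) auto
  then have b1: "1 - b \<le> real N ^ card fixed * (9/10) powr (n / 2)"
    using X(2) by (simp add: b_def add_divide_distrib)
  have a0: "a \<le> 1"
    using card_mono[OF finite_shift_lists good_sub] card_shift_lists n
    by (simp add: a_def divide_le_eq flip: of_nat_power)
  have b0: "b \<le> 1"
    using card_mono[OF X(1), of "?X - atypical"] X(2) by (simp add: b_def divide_le_eq)
  have "0 \<le> (1 - a) * (1 - b)" using a0 b0 by simp
  then have "1 - (1 - a) - (1 - b) \<le> a * b" by (simp add: algebra_simps)
  also have "a * b = real (card typical_seeds) / card (shift_lists \<times> ?X)"
    using X(2) card_shift_lists by (simp add: a_def b_def typical_seeds_def card_cartesian_product)
  also have "typical_seeds = (shift_lists \<times> ?X) \<inter> typical_seeds"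
    using good_sub by (auto simp: typical_seeds_def)
  also have "real (card ((shift_lists \<times> ?X) \<inter> typical_seeds)) / card (shift_lists \<times> ?X)
    = measure_pmf.prob (pmf_of_set (shift_lists \<times> ?X)) typical_seeds"
  proof (rule measure_pmf_of_set[symmetric])
    have "card (shift_lists \<times> ?X) > 0" using X(2) card_shift_lists n by (simp add: card_cartesian_product)
    then show "shift_lists \<times> ?X \<noteq> {}" "finite (shift_lists \<times> ?X)"
      unfolding card_gt_0_iff by blast+
  qed
  also have "\<dots> \<le> measure_pmf.prob (pmf_of_set (shift_lists \<times> ?X)) (D_out n enc -` (D_out n enc ` typical_seeds))"
    by (intro measure_pmf.finite_measure_mono) auto
  also have "\<dots> = measure_pmf.prob (D_dist n l enc) (D_out n enc ` typical_seeds)"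
    by (simp add: D_dist_def shift_lists_def)
  finally show ?thesis using a1 b1 by linarith
qed

text \<open>The ball decays like exp(-n / 20), and fixing the high-degree inputs gives back at most
  exp(n / 40). What remains is exp(-n / 40) times the cost of the inputs behind the shift
  bits.\<close>

lemma conditionings_le:
  "real N ^ card fixed * (9/10) powr (n / 2)
    \<le> exp (real d * real l * real k * log 2 (real N) - 1 / 40 * real n)"
proof -
  define L where "L = log 2 (real N)"
  have L: "L > 0" using N by (simp add: L_def)
  have ln2: "0 < ln (2::real)" "ln (2::real) \<le> 1" using ln_le_minus_one[of "2::real"] by auto
  have lnN: "ln (real N) = L * ln 2" by (simp add: L_def log_def)
  have "real (card fixed) * ln (real N) \<le> (real (d * (l * k)) + real n / (40 * L)) * ln (real N)"
    using card_fixed N by (intro mult_right_mono) (auto simp: L_def)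
  also have "\<dots> = (real d * real l * real k * L + real n / 40) * ln 2"
    using L by (simp add: lnN field_simps)
  also have "\<dots> \<le> (real d * real l * real k * L + real n / 40) * 1"
    using ln2 L by (intro mult_left_mono) auto
  finally have 1: "real (card fixed) * ln (real N) \<le> real d * real l * real k * L + real n / 40" by simp
  have "ln (9/10 :: real) \<le> - 1 / 10" using ln_le_minus_one[of "9/10::real"] by simp
  then have 2: "real n / 2 * ln (9/10) \<le> real n / 2 * (- 1 / 10)" by (intro mult_left_mono) auto
  have "real N ^ card fixed * (9/10) powr (n / 2) = exp (real (card fixed) * ln (real N) + real n / 2 * ln (9/10))"
    using N by (simp add: exp_add powr_def flip: ln_realpow)
  also have "\<dots> \<le> exp (real d * real l * real k * L - 1 / 40 * real n)"
    using 1 2 by simp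
  finally show ?thesis by (simp add: L_def)
qed

end

section \<open>From averages over assignments to total variation distance\<close>

lemma tv_dist_ge_compl: "measure_pmf.prob Q E - measure_pmf.prob P E \<le> tv_dist P Q"
proof -
  \<comment> \<open>The supremum is over P minus Q, while the test event is likely under Q; its
    complement has the required sign.\<close>
  have "measure_pmf.prob Q E - measure_pmf.prob P E
      = measure_pmf.prob P (- E) - measure_pmf.prob Q (- E)"
    using measure_pmf.prob_compl[of E P] measure_pmf.prob_compl[of E Q] by (simp add: Compl_eq_Diff_UNIV)
  also have "\<dots> \<le> tv_dist P Q"
    unfolding tv_dist_def
  proof (rule cSUP_upper)
    have "measure_pmf.prob P E - measure_pmf.prob Q E \<le> 1" for E
      using measure_pmf.prob_le_1[of P E] measure_nonneg[of Q E] by linarith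
    then show "bdd_above (range (\<lambda>E. measure_pmf.prob P E - measure_pmf.prob Q E))"
      by (intro bdd_aboveI[of _ 1]) auto
  qed simp
  finally show ?thesis .
qed

text \<open>Locality is only assumed on valid inputs, so assignments are first projected to the alphabet.\<close>

definition clip :: "nat \<Rightarrow> nat \<Rightarrow> nat" where
  "clip N a = (if a \<in> {1..N} then a else 1)"

definition on_assignment :: "nat \<Rightarrow> nat \<Rightarrow> (nat list \<Rightarrow> bool list) \<Rightarrow> (nat \<Rightarrow> nat) \<Rightarrow> bool list" where
  "on_assignment N m f z = f (map (\<lambda>i. clip N (z i)) [0..<m])"

lemma prob_unif_inputs:
  assumes "N \<ge> 1"
  shows "measure_pmf.prob (map_pmf f (unif_inputs N m)) E
    = avgs {1..N} {0..<m} (\<lambda>z. of_bool (on_assignment N m f z \<in> E)) z0"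
proof -
  interpret averaging "{1..N}" using assms by unfold_locales auto
  have eq: "inputs N m = {xs. set xs \<subseteq> {1..N} \<and> length xs = m}" by (auto simp: inputs_def)
  have fin: "finite (inputs N m)" "card (inputs N m) = N ^ m"
    unfolding eq using finite_lists_length_eq[of "{1..N}" m] card_lists_length_eq[of "{1..N}" m] by auto
  have ne: "inputs N m \<noteq> {}" using fin assms by (metis card.empty power_not_zero not_one_le_zero)
  have "avgs {1..N} {0..<m} (\<lambda>z. of_bool (on_assignment N m f z \<in> E)) z0
    = avgs {1..N} {0..<m} (\<lambda>z. of_bool (f (map z [0..<m]) \<in> E)) z0"
  proof (rule avgs_cong_off)
    fix z' assume "\<And>i. i \<in> {0..<m} \<Longrightarrow> z' i \<in> {1..N}"
    then have "map (\<lambda>i. clip N (z' i)) [0..<m] = map z' [0..<m]"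
      by (intro map_cong) (auto simp: clip_def)
    then show "of_bool (on_assignment N m f z' \<in> E) = of_bool (f (map z' [0..<m]) \<in> E)"
      by (simp only: on_assignment_def)
  qed simp
  also have "\<dots> = (\<Sum>xs\<in>inputs N m. of_bool (f xs \<in> E)) / real (card {1..N} ^ m)"
    unfolding inputs_def by (rule avgs_lists[where G = "\<lambda>xs. of_bool (f xs \<in> E)"])
  also have "\<dots> = real (card (inputs N m \<inter> f -` E)) / card (inputs N m)"
    using fin by (simp add: of_bool_def sum.If_cases Int_def)
  also have "\<dots> = measure_pmf.prob (unif_inputs N m) (f -` E)"
    unfolding unif_inputs_def using fin ne by (simp add: measure_pmf_of_set)
  finally show ?thesis by simp
qed

lemma d_local_supports:
  assumes f: "d_local N m L d f" and N: "N \<ge> 1"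
  shows "\<exists>S. \<forall>p<L. depends_on (\<lambda>z. on_assignment N m f z ! p) (S p) \<and> S p \<subseteq> {0..<m} \<and> card (S p) \<le> d"
proof -
  have "\<exists>T. depends_on (\<lambda>z. on_assignment N m f z ! p) T \<and> T \<subseteq> {0..<m} \<and> card T \<le> d" if p: "p < L" for p
  proof -
    have "\<exists>T\<subseteq>{0..<m}. card T \<le> d \<and>
        (\<forall>x\<in>inputs N m. \<forall>y\<in>inputs N m. (\<forall>i\<in>T. x ! i = y ! i) \<longrightarrow> f x ! p = f y ! p)"
      using f[unfolded d_local_def, THEN conjunct2, rule_format, OF p] .
    then obtain T where T: "T \<subseteq> {0..<m}" "card T \<le> d"
      and agree: "\<forall>x\<in>inputs N m. \<forall>y\<in>inputs N m. (\<forall>i\<in>T. x ! i = y ! i) \<longrightarrow> f x ! p = f y ! p"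
      by (elim exE conjE)
    have "depends_on (\<lambda>z. on_assignment N m f z ! p) T"
      unfolding on_assignment_def
    proof (rule depends_onI)
      fix z z' :: "nat \<Rightarrow> nat" assume eq: "\<And>i. i \<in> T \<Longrightarrow> z i = z' i"
      have "map (\<lambda>i. clip N (z i)) [0..<m] \<in> inputs N m" for z
        using N by (auto simp: inputs_def clip_def)
      moreover have "\<forall>i\<in>T. map (\<lambda>i. clip N (z i)) [0..<m] ! i = map (\<lambda>i. clip N (z' i)) [0..<m] ! i"
        using T(1) eq by (auto simp: subset_iff)
      ultimately show "f (map (\<lambda>i. clip N (z i)) [0..<m]) ! p = f (map (\<lambda>i. clip N (z' i)) [0..<m]) ! p"
        using agree by blast
    qed
    with T show ?thesis by blast
  qed
  then show ?thesis by metis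
qed

theorem theorem3:
  "\<exists>c1 c2 C :: real. c1 > 0 \<and> c2 > 0 \<and> C > 0 \<and>
    (\<forall>(m::nat) (d::nat) (l::nat) (n::nat) (N::nat) (k::nat)
        (enc :: nat \<Rightarrow> bool list) (f :: nat list \<Rightarrow> bool list).
      m \<ge> d \<and> d \<ge> 1 \<and> l \<ge> 1 \<and> n \<ge> 2 \<and> N \<ge> 2 \<and> n = 2 ^ k \<and>
      bij_betw enc {0..<n} {bs. length bs = k} \<and>
      d_local N m (l * k + (l + 1) * n) d f \<longrightarrow>
      tv_dist (map_pmf f (unif_inputs N m)) (D_dist n l enc)
        \<ge> 1 - exp (- c1 * real n / ((real l)^2 * real d * log 2 (real N)))
            - real d * (C * real d * log 2 (real N) / real n) ^ l
            - exp (real d * real l * log 2 (real n) * log 2 (real N) - c2 * real n))"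
proof (rule exI[of _ "1 / (2 ^ 25 * 40)"], rule exI[of _ "1 / 40"], rule exI[of _ 160], intro conjI allI impI)
  fix m d l n N k :: nat and enc :: "nat \<Rightarrow> bool list" and f :: "nat list \<Rightarrow> bool list"
  assume A: "m \<ge> d \<and> d \<ge> 1 \<and> l \<ge> 1 \<and> n \<ge> 2 \<and> N \<ge> 2 \<and> n = 2 ^ k \<and>
      bij_betw enc {0..<n} {bs. length bs = k} \<and> d_local N m (l * k + (l + 1) * n) d f"
  then obtain S where S: "\<And>p. p < l * k + (l + 1) * n \<Longrightarrow>
      depends_on (\<lambda>z. on_assignment N m f z ! p) (S p) \<and> S p \<subseteq> {0..<m} \<and> card (S p) \<le> d"
    using d_local_supports[of N m "l * k + (l + 1) * n" d f] by auto
  interpret sampler N m d l n k enc "on_assignment N m f" S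
  proof
    show "length (enc i) = k" if "i < n" for i
      using A that by (auto simp: bij_betw_def)
  qed (use A S in \<open>auto simp: bij_betw_def\<close>)
  let ?E = "D_out n enc ` typical_seeds"
  have k: "real k = log 2 (real n)" using A by simp
  \<comment> \<open>Since l is at least 1, the prefactor 4 of the collision bound is absorbed as
    4^l, so that C = 4 * 40 = 160.\<close>
  have "4 * real d * (thr / real n) ^ l \<le> 4 ^ l * real d * (thr / real n) ^ l"
    using A thr_pos by (intro mult_right_mono) (auto simp: self_le_power)
  also have "\<dots> = real d * (160 * real d * log 2 (real N) / real n) ^ l"
    by (simp add: thr_def power_mult_distrib[symmetric] mult_ac flip: power_mult_distrib)
  finally have C: "4 * real d * (thr / real n) ^ l \<le> real d * (160 * real d * log 2 (real N) / real n) ^ l" .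
  have "measure_pmf.prob (map_pmf f (unif_inputs N m)) ?E
    \<le> exp (- (1 / (2 ^ 25 * 40)) * real n / ((real l)\<^sup>2 * real d * log 2 (real N)))"
    using prob_typical_sampled[of "\<lambda>_. 1"] prob_unif_inputs[of N f m ?E "\<lambda>_. 1"] A by simp
  then show "tv_dist (map_pmf f (unif_inputs N m)) (D_dist n l enc)
      \<ge> 1 - exp (- (1 / (2 ^ 25 * 40)) * real n / ((real l)^2 * real d * log 2 (real N)))
          - real d * (160 * real d * log 2 (real N) / real n) ^ l
          - exp (real d * real l * log 2 (real n) * log 2 (real N) - 1 / 40 * real n)"
    using prob_typical_D conditionings_le C k
      tv_dist_ge_compl[of "D_dist n l enc" ?E "map_pmf f (unif_inputs N m)"] by (simp only: k)
qed auto

end
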